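(* Let $\mathcal{G}=(X,Y,A,B,\lambda)$ be a mirror game, let $p\in\mathcal{C}_{\rm qc}(\lambda)$, and let $s$ be a state on $\mathcal{A}(X,A)\otimes_{\max}\mathcal{A}(Y,B)$ such that $p=p_s$, that is, $p(a,b|x,y)=s(e_{x,a}\otimes f_{y,b})$ for all $x\in X,y\in Y,a\in A,b\in B$. Then (i) the functional $\tau:\mathcal{A}(X,A)\to\mathbb{C}$ given by $\tau(z)=s(z\otimes1)$, $z\in\mathcal{A}(X,A)$, is a trace; (ii) there exists a unital *-homomorphism $\rho:\mathcal{A}(Y,B)\to\mathcal{A}(X,A)$ such that $$p(a,b|x,y)=\tau(e_{x,a}\rho(f_{y,b})),\quad x\in X,\ y\in Y,\ a\in A,\ b\in B,$$ and $$s(z\otimes f_{y_1,b_1}\cdots f_{y_k,b_k})=\tau(z\,\rho(f_{y_k,b_k}\cdots f_{y_1,b_1}))$$ for all $z\in\mathcal{A}(X,A)$, $k\in\mathbb{N}$, $y_i\in Y$, $b_i\in B$, $i=1,\dots,k$.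
   Context: $X,Y,A,B$ are finite non-empty sets. A non-signalling game is a tuple $(X,Y,A,B,\lambda)$ with $\lambda:X\times Y\times A\times B\to\{0,1\}$. It is a mirror game if there exist functions $\xi:X\to Y$ and $\eta:Y\to X$ such that $\lambda(x,\xi(x),a,b)\lambda(x,\xi(x),a',b)=0$ for all $x\in X$, $b\in B$, $a,a'\in A$ with $a\ne a'$, and $\lambda(\eta(y),y,a,b)\lambda(\eta(y),y,a,b')=0$ for all $y\in Y$, $a\in A$, $b,b'\in B$ with $b\neq b'$. $\mathcal{A}(X,A)$ is the unital C*-algebra free product, amalgamated over the unit, of $|X|$ copies of $\ell^\infty(A)$, indexed by $X$; $(e_{x,a})_{a\in A}$ is the canonical basis of the $x$-th copy. The corresponding generators of $\mathcal{A}(Y,B)$ are denoted $f_{y,b}$. $\otimes_{\max}$ is the maximal C*-tensor product. A trace on a C*-algebra is a positive linear functional $\tau$ with $\tau(zw)=\tau(wz)$ for all $z,w$. A PVM is a finite tuple of projections on a Hilbert space summing to the identity. $\mathcal{C}_{\rm qc}$ is the set of families $p(a,b|x,y)=\langle\zeta|P_{x,a}Q_{y,b}|\zeta\rangle$ with $\zeta$ a unit vector in a Hilbert space $\mathcal{H}$, $(P_{x,a})_{a\in A}$, $(Q_{y,b})_{b\in B}$ PVMs on $\mathcal{H}$ for all $x,y$, with $P_{x,a}Q_{y,b}=Q_{y,b}P_{x,a}$ for all $x,y,a,b$. $\mathcal{C}_{\rm qc}(\lambda)=\{p\in\mathcal{C}_{\rm qc}:\lambda(x,y,a,b)=0\Rightarrow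 p(a,b|x,y)=0\}$. *)

theory Defs
  imports "HOL-Analysis.Analysis"
begin

section \<open>Complex *-algebras and C*-algebras\<close>

class scaleC = scaleR +
  fixes scaleC :: "complex \<Rightarrow> 'a \<Rightarrow> 'a"  (infixr \<open>*\<^sub>C\<close> 75)
  assumes scaleR_scaleC: "scaleR r = scaleC (complex_of_real r)"

class complex_vector = scaleC + ab_group_add +
  assumes scaleC_add_right: "c *\<^sub>C (x + y) = c *\<^sub>C x + c *\<^sub>C y"
    and scaleC_add_left: "(c + d) *\<^sub>C x = c *\<^sub>C x + d *\<^sub>C x"
    and scaleC_scaleC [simp]: "c *\<^sub>C d *\<^sub>C x = (c * d) *\<^sub>C x"
    and scaleC_one [simp]: "1 *\<^sub>C x = x"

subclass (in complex_vector) real_vector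
  by standard (simp_all add: scaleR_scaleC scaleC_add_right scaleC_add_left)

class star =
  fixes star :: "'a \<Rightarrow> 'a"

text \<open>Unital complex *-algebras. The class \<open>ring_1\<close> is avoided so that the zero algebra
  is not excluded.\<close>

class star_algebra = complex_vector + ring + monoid_mult + star +
  assumes mult_scaleC_left [simp]: "(c *\<^sub>C x) * y = c *\<^sub>C (x * y)"
    and mult_scaleC_right [simp]: "x * (c *\<^sub>C y) = c *\<^sub>C (x * y)"
    and star_star [simp]: "star (star x) = x"
    and star_add [simp]: "star (x + y) = star x + star y"
    and star_scaleC [simp]: "star (c *\<^sub>C x) = cnj c *\<^sub>C star x"
    and star_mult [simp]: "star (x * y) = star y * star x"

subclass (in star_algebra) real_algebra
  by standard (simp_all add: scaleR_scaleC)

class cstar_algebra = star_algebra + real_normed_algebra + banach +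
  assumes norm_scaleC: "norm (c *\<^sub>C x) = cmod c * norm x"
    and cstar_identity: "norm (star x * x) = (norm x)\<^sup>2"

definition (in star_algebra) cstar_seminorm :: "('a \<Rightarrow> real) \<Rightarrow> bool" where
  "cstar_seminorm p \<longleftrightarrow>
     (\<forall>x y. p (x + y) \<le> p x + p y) \<and>
     (\<forall>c x. p (c *\<^sub>C x) = cmod c * p x) \<and>
     (\<forall>x y. p (x * y) \<le> p x * p y) \<and>
     (\<forall>x. p (star x * x) = (p x)\<^sup>2)"

definition unital_star_hom :: "('a::star_algebra \<Rightarrow> 'b::star_algebra) \<Rightarrow> bool" where
  "unital_star_hom \<phi> \<longleftrightarrow>
     (\<forall>x y. \<phi> (x + y) = \<phi> x + \<phi> y) \<and>
     (\<forall>c x. \<phi> (c *\<^sub>C x) = c *\<^sub>C \<phi> x) \<and>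
     (\<forall>x y. \<phi> (x * y) = \<phi> x * \<phi> y) \<and>
     (\<forall>x. \<phi> (star x) = star (\<phi> x)) \<and>
     \<phi> 1 = 1"

definition linear_functional :: "('a::star_algebra \<Rightarrow> complex) \<Rightarrow> bool" where
  "linear_functional f \<longleftrightarrow>
     (\<forall>x y. f (x + y) = f x + f y) \<and> (\<forall>c x. f (c *\<^sub>C x) = c * f x)"

definition positive_functional :: "('a::cstar_algebra \<Rightarrow> complex) \<Rightarrow> bool" where
  "positive_functional f \<longleftrightarrow> linear_functional f \<and> (\<forall>x. f (star x * x) \<in> \<real>\<^sub>\<ge>\<^sub>0)"

definition is_state :: "('a::cstar_algebra \<Rightarrow> complex) \<Rightarrow> bool" where
  "is_state f \<longleftrightarrow> positive_functional f \<and> f 1 = 1"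

definition is_trace :: "('a::cstar_algebra \<Rightarrow> complex) \<Rightarrow> bool" where
  "is_trace f \<longleftrightarrow> positive_functional f \<and> (\<forall>z w. f (z * w) = f (w * z))"


subsection \<open>Elementary consequences\<close>

lemma scaleC_zero_left [simp]: "0 *\<^sub>C x = (0 :: 'a::complex_vector)"
  using scaleC_add_left[of 0 0 x] by simp

lemma scaleC_zero_right [simp]: "c *\<^sub>C 0 = (0 :: 'a::complex_vector)"
  using scaleC_add_right[of c 0 0] by simp

lemma scaleC_minus_one: "(-1) *\<^sub>C x = - (x :: 'a::complex_vector)"
  using scaleC_add_left[of 1 "-1" x] by (simp add: eq_neg_iff_add_eq_0 add.commute)

lemma scaleC_minus_right: "c *\<^sub>C (- x) = - (c *\<^sub>C x :: 'a::complex_vector)"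
  using scaleC_add_right[of c x "-x"] by (simp add: eq_neg_iff_add_eq_0 add.commute)

lemma scaleC_diff_right: "c *\<^sub>C (x - y) = c *\<^sub>C x - (c *\<^sub>C y :: 'a::complex_vector)"
  using scaleC_add_right[of c x "-y"] by (simp add: scaleC_minus_right)

lemma scaleC_sum_right: "c *\<^sub>C (\<Sum>i\<in>I. f i) = (\<Sum>i\<in>I. c *\<^sub>C (f i :: 'a::complex_vector))"
  by (induction I rule: infinite_finite_induct) (simp_all add: scaleC_add_right)

lemma star_zero [simp]: "star 0 = (0 :: 'a::star_algebra)"
  using star_add[of 0 "0::'a"] by simp

lemma star_minus [simp]: "star (- x) = - star (x :: 'a::star_algebra)"
  using star_scaleC[of "-1" x] by (simp add: scaleC_minus_one)

lemma star_diff [simp]: "star (x - y) = star x - star (y :: 'a::star_algebra)"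
  using star_add[of x "-y"] by simp

lemma star_one [simp]: "star 1 = (1 :: 'a::star_algebra)"
  by (metis mult_1_left mult_1_right star_mult star_star)

lemma star_scaleR [simp]: "star (r *\<^sub>R x) = r *\<^sub>R star (x :: 'a::star_algebra)"
  by (simp add: scaleR_scaleC)

context
  fixes p :: "'a::star_algebra \<Rightarrow> real"
  assumes p: "cstar_seminorm p"
begin

lemma csn_triangle: "p (x + y) \<le> p x + p y"
  and csn_scaleC: "p (c *\<^sub>C x) = cmod c * p x"
  and csn_mult: "p (x * y) \<le> p x * p y"
  and csn_star_mult: "p (star x * x) = (p x)\<^sup>2"
  using p by (auto simp: cstar_seminorm_def)

lemma csn_zero: "p 0 = 0"
  using csn_scaleC[of 0 0] by simp

lemma csn_minus: "p (- x) = p x"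
  using csn_scaleC[of "-1" x] by (simp add: scaleC_minus_one)

lemma csn_nonneg: "0 \<le> p x"
  using csn_triangle[of x "-x"] by (simp add: csn_zero csn_minus)

lemma csn_diff: "p (x - y) \<le> p x + p y"
  using csn_triangle[of x "-y"] by (simp add: csn_minus)

lemma csn_diff_commute: "p (x - y) = p (y - x)"
  using csn_minus[of "x - y"] by simp

lemma csn_abs_diff: "\<bar>p x - p y\<bar> \<le> p (x - y)"
  using csn_triangle[of "x - y" y] csn_triangle[of "y - x" x] csn_diff_commute[of x y] by simp

lemma csn_star: "p (star x) = p x"
proof -
  have le: "p y \<le> p (star y)" for y
  proof (cases "p y = 0")
    case False
    have "p y * p y \<le> p (star y) * p y"
      using csn_star_mult[of y] csn_mult[of "star y" y] by (simp add: power2_eq_square)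
    with False csn_nonneg[of y] show ?thesis by simp
  qed (simp add: csn_nonneg)
  show ?thesis using le[of x] le[of "star x"] by simp
qed

lemma csn_one: "p 1 \<le> 1"
proof -
  have "p 1 = p 1 * p 1" using csn_star_mult[of 1] by (simp add: power2_eq_square)
  then show ?thesis by (cases "p 1 = 0") auto
qed

lemma csn_sum: "p (\<Sum>i\<in>I. f i) \<le> (\<Sum>i\<in>I. p (f i))"
proof (induction I rule: infinite_finite_induct)
  case (insert i I)
  then show ?case using csn_triangle[of "f i" "sum f I"] by simp
qed (simp_all add: csn_zero)

end

lemma cstar_seminorm_norm: "cstar_seminorm (norm :: 'a::cstar_algebra \<Rightarrow> real)"
  by (simp add: cstar_seminorm_def norm_triangle_ineq norm_scaleC norm_mult_ineq cstar_identity)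

lemma norm_star [simp]: "norm (star x) = norm (x :: 'a::cstar_algebra)"
  by (rule csn_star[OF cstar_seminorm_norm])

lemma bounded_linear_star: "bounded_linear (star :: 'a::cstar_algebra \<Rightarrow> 'a)"
  by (rule bounded_linear_intro[where K = 1]) simp_all

lemma star_power: "star (x ^ n) = star (x :: 'a::star_algebra) ^ n"
  by (induction n) (simp_all add: power_commutes)

lemma cstar_norm_power: "norm (x ^ n) \<le> norm (x :: 'a::cstar_algebra) ^ n"
proof (induction n)
  case 0
  then show ?case using csn_one[OF cstar_seminorm_norm[where 'a='a]] by simp
next
  case (Suc n)
  have "norm (x * x ^ n) \<le> norm x * norm (x ^ n)" by (rule norm_mult_ineq)
  also have "\<dots> \<le> norm x * norm x ^ n" using Suc by (simp add: mult_left_mono)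
  finally show ?case by simp
qed

lemma cstar_sqrt:
  fixes a :: "'a::cstar_algebra"
  assumes a: "norm a < 1" and sa: "star a = a"
  obtains k where "star k = k" "k * k = 1 - a" "\<And>h. h * a = a * h \<Longrightarrow> h * k = k * h"
proof -
  define c where "c n = ((1/2) gchoose n :: real)" for n
  define t where "t n = c n *\<^sub>R (- a) ^ n" for n
  have "summable (\<lambda>n. norm (c n * norm a ^ n))"
  proof (rule abs_summable_in_conv_radius)
    have "conv_radius c \<ge> 1"
      unfolding c_def by (subst conv_radius_gchoose) auto
    then show "ereal (norm (norm a)) < conv_radius c"
      using a by (simp add: less_le_trans[of _ 1] one_ereal_def)
  qed
  then have sn: "summable (\<lambda>n. norm (t n))"
    by (rule summable_comparison_test[rotated])
       (use cstar_norm_power[of "-a"] in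
          \<open>auto simp: t_def abs_mult intro!: exI[of _ 0] mult_left_mono\<close>)
  then have s: "summable t" by (rule summable_norm_cancel)
  define k where "k = (\<Sum>n. t n)"
  have "star k = (\<Sum>n. star (t n))"
    unfolding k_def by (rule bounded_linear.suminf[OF bounded_linear_star s])
  also have "\<dots> = k"
    by (simp add: k_def t_def star_power sa)
  finally have 1: "star k = k" .
  have "(\<lambda>n. \<Sum>i\<le>n. t i * t (n - i)) sums (k * k)"
    unfolding k_def by (rule Cauchy_product_sums[OF sn sn])
  moreover have "(\<Sum>i\<le>n. t i * t (n - i)) = (1 gchoose n :: real) *\<^sub>R (- a) ^ n" for n
  proof -
    have "(\<Sum>i\<le>n. t i * t (n - i)) = (\<Sum>i\<le>n. (c i * c (n - i)) *\<^sub>R (- a) ^ n)"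
      by (rule sum.cong) (auto simp: t_def simp flip: power_add)
    also have "\<dots> = (\<Sum>i\<le>n. c i * c (n - i)) *\<^sub>R (- a) ^ n"
      by (simp add: scaleR_sum_left)
    also have "(\<Sum>i\<le>n. c i * c (n - i)) = (1 gchoose n)"
      using gbinomial_Vandermonde[of "1/2 :: real" "1/2" n] by (simp add: c_def atMost_atLeast0)
    finally show ?thesis .
  qed
  ultimately have "(\<lambda>n. (1 gchoose n :: real) *\<^sub>R (- a) ^ n) sums (k * k)" by simp
  moreover have "(\<lambda>n. (1 gchoose n :: real) *\<^sub>R (- a) ^ n) sums (\<Sum>n\<in>{0,1}. (1 gchoose n :: real) *\<^sub>R (- a) ^ n)"
  proof (rule sums_finite)
    fix n :: nat assume "n \<notin> {0,1}"
    then have "(1 gchoose n :: real) = 0"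
      using binomial_gbinomial[of 1 n, where ?'a = real] by (simp add: binomial_eq_0)
    then show "(1 gchoose n :: real) *\<^sub>R (- a) ^ n = 0" by simp
  qed simp
  ultimately have "k * k = (\<Sum>n\<in>{0,1}. (1 gchoose n :: real) *\<^sub>R (- a) ^ n)"
    by (rule sums_unique2)
  then have 2: "k * k = 1 - a" by simp
  have 3: "h * k = k * h" if h: "h * a = a * h" for h
  proof -
    have "h * (- a) ^ n = (- a) ^ n * h" for n
    proof (induction n)
      case (Suc n)
      have "h * (- a) ^ Suc n = (h * (- a)) * (- a) ^ n" by (simp add: mult.assoc)
      also have "\<dots> = (- a) * (h * (- a) ^ n)" by (simp add: h mult.assoc)
      also have "\<dots> = (- a) ^ Suc n * h" by (simp add: Suc mult.assoc)
      finally show ?case .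
    qed simp
    then show ?thesis
      unfolding k_def suminf_mult[OF s, symmetric] suminf_mult2[OF s]
      by (simp add: t_def)
  qed
  show ?thesis by (rule that[OF 1 2 3])
qed

lemma cstar_seminorm_le_norm:
  fixes q :: "'a::cstar_algebra \<Rightarrow> real"
  assumes q: "cstar_seminorm q"
  shows "q x \<le> norm x"
proof -
  have sa: "q h \<le> norm h" if h: "star h = h" for h
  proof (rule dense_ge)
    fix r assume r: "norm h < r"
    then have r0: "r > 0" using norm_ge_zero[of h] by linarith
    define g where "g = (1 / r) *\<^sub>R h"
    have g: "norm g < 1" "star g = g" using r r0 h by (simp_all add: g_def)
    have "norm (g * g) \<le> norm g * norm g" by (rule norm_mult_ineq)
    also have "\<dots> < 1" using g mult_strict_mono[of "norm g" 1 "norm g" 1] by simp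
    finally obtain k where k: "star k = k" "k * k = 1 - g * g"
      and kc: "\<And>h. h * (g * g) = (g * g) * h \<Longrightarrow> h * k = k * h"
      using cstar_sqrt[of "g * g"] g by (metis star_mult)
    have gk: "g * k = k * g" by (rule kc) (simp add: mult.assoc)
    define u where "u = g + \<i> *\<^sub>C k"
    have su: "star u = g + (- \<i>) *\<^sub>C k" by (simp add: u_def g k)
    have "star u * u = g * g + \<i> *\<^sub>C (g * k) + ((- \<i>) *\<^sub>C (k * g) + k * k)"
      unfolding su by (simp add: u_def distrib_left distrib_right scaleC_add_right)
    also have "\<dots> = g * g + k * k + (\<i> + (- \<i>)) *\<^sub>C (k * g)"
      unfolding gk scaleC_add_left by (simp only: ac_simps)
    also have "\<dots> = 1" by (simp add: k)
    finally have "(q u)\<^sup>2 = q 1" by (simp flip: csn_star_mult[OF q])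
    then have "(q u)\<^sup>2 \<le> 1" using csn_one[OF q] by simp
    then have qu: "q u \<le> 1" using csn_nonneg[OF q, of u] by (simp add: power_le_one_iff)
    have "u + star u = 2 *\<^sub>C g"
    proof -
      have "u + star u = g + g + (\<i> + (- \<i>)) *\<^sub>C k"
        unfolding su scaleC_add_left by (simp only: u_def ac_simps)
      also have "\<dots> = g + g" by simp
      also have "\<dots> = 2 *\<^sub>C g" using scaleC_add_left[of 1 1 g] by simp
      finally show ?thesis .
    qed
    then have "2 * q g = q (u + star u)" by (simp add: csn_scaleC[OF q])
    also have "\<dots> \<le> 2" using csn_triangle[OF q, of u "star u"] qu by (simp add: csn_star[OF q])
    finally have "q g \<le> 1" by simp
    moreover have "h = complex_of_real r *\<^sub>C g"
      using r0 by (simp add: g_def flip: scaleR_scaleC)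
    ultimately show "q h \<le> r" using r0 by (simp add: csn_scaleC[OF q])
  qed
  have "(q x)\<^sup>2 \<le> (norm x)\<^sup>2"
    using sa[of "star x * x"] by (simp add: csn_star_mult[OF q] cstar_identity)
  then show ?thesis using norm_ge_zero power2_le_imp_le by blast
qed


section \<open>Hausdorff completion with respect to a C*-seminorm\<close>

class cstar_seminormed = star_algebra +
  fixes usn :: "'a \<Rightarrow> real"
  assumes cstar_seminorm_usn: "cstar_seminorm usn"

lemmas usn_triangle = csn_triangle[OF cstar_seminorm_usn]
  and usn_scaleC = csn_scaleC[OF cstar_seminorm_usn]
  and usn_mult = csn_mult[OF cstar_seminorm_usn]
  and usn_star_mult = csn_star_mult[OF cstar_seminorm_usn]
  and usn_zero [simp] = csn_zero[OF cstar_seminorm_usn]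
  and usn_minus [simp] = csn_minus[OF cstar_seminorm_usn]
  and usn_nonneg [simp] = csn_nonneg[OF cstar_seminorm_usn]
  and usn_diff = csn_diff[OF cstar_seminorm_usn]
  and usn_diff_commute = csn_diff_commute[OF cstar_seminorm_usn]
  and usn_abs_diff = csn_abs_diff[OF cstar_seminorm_usn]
  and usn_star [simp] = csn_star[OF cstar_seminorm_usn]

definition usn_Cauchy :: "(nat \<Rightarrow> 'a::cstar_seminormed) \<Rightarrow> bool" where
  "usn_Cauchy X \<longleftrightarrow> (\<forall>e>0. \<exists>N. \<forall>m\<ge>N. \<forall>n\<ge>N. usn (X m - X n) < e)"

definition usn_equiv :: "(nat \<Rightarrow> 'a::cstar_seminormed) \<Rightarrow> (nat \<Rightarrow> 'a) \<Rightarrow> bool" where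
  "usn_equiv X Y \<longleftrightarrow> usn_Cauchy X \<and> usn_Cauchy Y \<and> (\<lambda>n. usn (X n - Y n)) \<longlonglongrightarrow> 0"

lemma usn_null_le:
  fixes X Y :: "nat \<Rightarrow> 'a::cstar_seminormed"
  assumes "f \<longlonglongrightarrow> (0::real)" "\<And>n. usn (X n) \<le> f n"
  shows "(\<lambda>n. usn (X n)) \<longlonglongrightarrow> 0"
  by (rule tendsto_sandwich[OF _ _ tendsto_const assms(1)]) (simp_all add: assms(2))

lemma usn_Cauchy_const: "usn_Cauchy (\<lambda>n. x)"
  by (simp add: usn_Cauchy_def)

lemma usn_Cauchy_lipschitz:
  assumes X: "usn_Cauchy X" and K: "\<And>m n. usn (Y m - Y n) \<le> K * usn (X m - X n)"
  shows "usn_Cauchy Y"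
  unfolding usn_Cauchy_def
proof (intro allI impI)
  fix e :: real assume "e > 0"
  then have "e / (\<bar>K\<bar> + 1) > 0" by simp
  then obtain N where N: "\<And>m n. m \<ge> N \<Longrightarrow> n \<ge> N \<Longrightarrow> usn (X m - X n) < e / (\<bar>K\<bar> + 1)"
    using X unfolding usn_Cauchy_def by meson
  have "usn (Y m - Y n) < e" if "m \<ge> N" "n \<ge> N" for m n
  proof -
    have "usn (Y m - Y n) \<le> (\<bar>K\<bar> + 1) * usn (X m - X n)"
      by (rule order_trans[OF K mult_right_mono]) simp_all
    also have "\<dots> < e" using N[OF that] by (simp add: field_simps)
    finally show ?thesis .
  qed
  then show "\<exists>N. \<forall>m\<ge>N. \<forall>n\<ge>N. usn (Y m - Y n) < e" by blast
qed

lemma usn_Cauchy_add: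
  assumes X: "usn_Cauchy X" and Y: "usn_Cauchy Y"
  shows "usn_Cauchy (\<lambda>n. X n + Y n)"
  unfolding usn_Cauchy_def
proof (intro allI impI)
  fix e :: real assume "e > 0"
  then have e: "e / 2 > 0" by simp
  obtain N1 where N1: "\<And>m n. m \<ge> N1 \<Longrightarrow> n \<ge> N1 \<Longrightarrow> usn (X m - X n) < e / 2"
    using X e unfolding usn_Cauchy_def by meson
  obtain N2 where N2: "\<And>m n. m \<ge> N2 \<Longrightarrow> n \<ge> N2 \<Longrightarrow> usn (Y m - Y n) < e / 2"
    using Y e unfolding usn_Cauchy_def by meson
  have "usn (X m + Y m - (X n + Y n)) < e" if "m \<ge> max N1 N2" "n \<ge> max N1 N2" for m n
  proof -
    have "usn (X m + Y m - (X n + Y n)) \<le> usn (X m - X n) + usn (Y m - Y n)"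
      unfolding add_diff_add by (rule usn_triangle)
    with N1[of m n] N2[of m n] that show ?thesis by simp
  qed
  then show "\<exists>N. \<forall>m\<ge>N. \<forall>n\<ge>N. usn (X m + Y m - (X n + Y n)) < e" by blast
qed

lemma usn_Cauchy_scaleC: "usn_Cauchy X \<Longrightarrow> usn_Cauchy (\<lambda>n. c *\<^sub>C X n)"
  by (erule usn_Cauchy_lipschitz[where K = "cmod c"])
     (simp add: usn_scaleC flip: scaleC_diff_right)

lemma usn_Cauchy_minus: "usn_Cauchy X \<Longrightarrow> usn_Cauchy (\<lambda>n. - X n)"
  using usn_Cauchy_scaleC[of X "-1"] by (simp add: scaleC_minus_one)

lemma usn_Cauchy_diff: "usn_Cauchy X \<Longrightarrow> usn_Cauchy Y \<Longrightarrow> usn_Cauchy (\<lambda>n. X n - Y n)"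
  using usn_Cauchy_add[of X "\<lambda>n. - Y n"] by (simp add: usn_Cauchy_minus)

lemma usn_Cauchy_star: "usn_Cauchy X \<Longrightarrow> usn_Cauchy (\<lambda>n. star (X n))"
  by (erule usn_Cauchy_lipschitz[where K = 1]) (simp flip: star_diff)

lemma usn_Cauchy_real: "usn_Cauchy X \<Longrightarrow> convergent (\<lambda>n. usn (X n))"
proof (rule Cauchy_convergent, rule metric_CauchyI)
  fix e :: real assume X: "usn_Cauchy X" and "e > 0"
  then obtain N where N: "\<And>m n. m \<ge> N \<Longrightarrow> n \<ge> N \<Longrightarrow> usn (X m - X n) < e"
    unfolding usn_Cauchy_def by meson
  show "\<exists>N. \<forall>m\<ge>N. \<forall>n\<ge>N. dist (usn (X m)) (usn (X n)) < e"
    using N usn_abs_diff by (metis dist_real_def le_less_trans)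
qed

lemma usn_Cauchy_bounded:
  assumes "usn_Cauchy X"
  obtains B where "B > 0" "\<And>n. usn (X n) \<le> B"
proof -
  have "Bseq (\<lambda>n. usn (X n))"
    using usn_Cauchy_real[OF assms] by (rule convergent_imp_Bseq)
  then show ?thesis
    by (metis BseqE norm_ge_zero abs_of_nonneg real_norm_def that usn_nonneg)
qed

lemma usn_mult_diff: "usn (x * y - x' * y') \<le> usn x * usn (y - y') + usn (x - x') * usn y'"
proof -
  have "x * y - x' * y' = x * (y - y') + (x - x') * y'" by (simp add: algebra_simps)
  then have "usn (x * y - x' * y') \<le> usn (x * (y - y')) + usn ((x - x') * y')"
    by (simp add: usn_triangle)
  with usn_mult[of x "y - y'"] usn_mult[of "x - x'" y'] show ?thesis by linarith
qed

lemma usn_Cauchy_mult: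
  assumes X: "usn_Cauchy X" and Y: "usn_Cauchy Y"
  shows "usn_Cauchy (\<lambda>n. X n * Y n)"
  unfolding usn_Cauchy_def
proof (intro allI impI)
  fix e :: real assume "e > 0"
  obtain B where B: "B > 0" "\<And>n. usn (X n) \<le> B" using usn_Cauchy_bounded[OF X] by blast
  obtain C where C: "C > 0" "\<And>n. usn (Y n) \<le> C" using usn_Cauchy_bounded[OF Y] by blast
  have e1: "e / (2 * C) > 0" and e2: "e / (2 * B) > 0" using \<open>e > 0\<close> B C by simp_all
  obtain N1 where N1: "\<And>m n. m \<ge> N1 \<Longrightarrow> n \<ge> N1 \<Longrightarrow> usn (X m - X n) < e / (2 * C)"
    using X e1 unfolding usn_Cauchy_def by meson
  obtain N2 where N2: "\<And>m n. m \<ge> N2 \<Longrightarrow> n \<ge> N2 \<Longrightarrow> usn (Y m - Y n) < e / (2 * B)"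
    using Y e2 unfolding usn_Cauchy_def by meson
  have "usn (X m * Y m - X n * Y n) < e" if mn: "m \<ge> max N1 N2" "n \<ge> max N1 N2" for m n
  proof -
    have "usn (X m * Y m - X n * Y n) \<le> B * usn (Y m - Y n) + usn (X m - X n) * C"
      by (rule order_trans[OF usn_mult_diff add_mono])
         (auto intro: mult_right_mono mult_left_mono B C)
    moreover have "B * usn (Y m - Y n) < e / 2" using N2[of m n] mn B by (simp add: field_simps)
    moreover have "usn (X m - X n) * C < e / 2" using N1[of m n] mn C by (simp add: field_simps)
    ultimately show ?thesis by simp
  qed
  then show "\<exists>N. \<forall>m\<ge>N. \<forall>n\<ge>N. usn (X m * Y m - X n * Y n) < e" by blast
qed

lemma usn_equiv_refl: "usn_Cauchy X \<Longrightarrow> usn_equiv X X"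
  by (simp add: usn_equiv_def)

lemma part_equivp_usn_equiv:
  "part_equivp (usn_equiv :: (nat \<Rightarrow> 'a::cstar_seminormed) \<Rightarrow> _)"
proof (rule part_equivpI)
  let ?R = "usn_equiv :: (nat \<Rightarrow> 'a) \<Rightarrow> _"
  show "\<exists>X. ?R X X" using usn_equiv_refl usn_Cauchy_const by blast
  show "symp ?R" by (rule sympI) (simp add: usn_equiv_def usn_diff_commute)
  show "transp ?R"
  proof (rule transpI)
    fix X Y Z :: "nat \<Rightarrow> 'a"
    assume *: "usn_equiv X Y" "usn_equiv Y Z"
    have "(\<lambda>n. usn (X n - Z n)) \<longlonglongrightarrow> 0"
    proof (rule usn_null_le)
      show "(\<lambda>n. usn (X n - Y n) + usn (Y n - Z n)) \<longlonglongrightarrow> 0"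
        using * unfolding usn_equiv_def by (auto intro: tendsto_add_zero)
      show "usn (X n - Z n) \<le> usn (X n - Y n) + usn (Y n - Z n)" for n
        using usn_triangle[of "X n - Y n" "Y n - Z n"] by simp
    qed
    with * show "usn_equiv X Z" by (simp add: usn_equiv_def)
  qed
qed

quotient_type (overloaded) 'a completion = "nat \<Rightarrow> 'a::cstar_seminormed" / partial: usn_equiv
  by (rule part_equivp_usn_equiv)

lemma usn_equiv_eqI: "usn_Cauchy X \<Longrightarrow> (\<And>n. X n = Y n) \<Longrightarrow> usn_equiv X Y"
  using usn_equiv_refl[of X] by (metis ext)

lemma usn_equiv_CauchyD: "usn_equiv X Y \<Longrightarrow> usn_Cauchy X" "usn_equiv X Y \<Longrightarrow> usn_Cauchy Y"
  by (simp_all add: usn_equiv_def)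

lemma usn_equiv_lipschitz:
  assumes "usn_equiv X X'" "usn_Cauchy Y" "usn_Cauchy Y'" "\<And>n. usn (Y n - Y' n) \<le> K * usn (X n - X' n)"
  shows "usn_equiv Y Y'"
  unfolding usn_equiv_def
proof (intro conjI assms usn_null_le[of "\<lambda>n. K * usn (X n - X' n)"])
  show "(\<lambda>n. K * usn (X n - X' n)) \<longlonglongrightarrow> 0"
    using assms(1) by (auto simp: usn_equiv_def intro: tendsto_mult_right_zero)
qed

lemma usn_equiv_add:
  assumes "usn_equiv X X'" "usn_equiv Y Y'"
  shows "usn_equiv (\<lambda>n. X n + Y n) (\<lambda>n. X' n + Y' n)"
  unfolding usn_equiv_def
proof (intro conjI usn_Cauchy_add usn_null_le[of "\<lambda>n. usn (X n - X' n) + usn (Y n - Y' n)"])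
  show "(\<lambda>n. usn (X n - X' n) + usn (Y n - Y' n)) \<longlonglongrightarrow> 0"
    using assms unfolding usn_equiv_def by (auto intro: tendsto_add_zero)
  show "usn (X n + Y n - (X' n + Y' n)) \<le> usn (X n - X' n) + usn (Y n - Y' n)" for n
    unfolding add_diff_add by (rule usn_triangle)
qed (use assms usn_equiv_CauchyD in blast)+

lemma usn_equiv_scaleC:
  assumes "usn_equiv X X'" shows "usn_equiv (\<lambda>n. c *\<^sub>C X n) (\<lambda>n. c *\<^sub>C X' n)"
  by (rule usn_equiv_lipschitz[OF assms, where K = "cmod c"])
     (use assms in \<open>auto simp: usn_scaleC intro: usn_Cauchy_scaleC usn_equiv_CauchyD simp flip: scaleC_diff_right\<close>)

lemma usn_equiv_star:
  assumes "usn_equiv X X'" shows "usn_equiv (\<lambda>n. star (X n)) (\<lambda>n. star (X' n))"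
  by (rule usn_equiv_lipschitz[OF assms, where K = 1])
     (use assms in \<open>auto intro: usn_Cauchy_star usn_equiv_CauchyD simp flip: star_diff\<close>)

lemma usn_equiv_minus:
  assumes "usn_equiv X X'" shows "usn_equiv (\<lambda>n. - X n) (\<lambda>n. - X' n)"
  using usn_equiv_scaleC[OF assms, of "-1"] by (simp add: scaleC_minus_one)

lemma usn_equiv_diff:
  assumes "usn_equiv X X'" "usn_equiv Y Y'"
  shows "usn_equiv (\<lambda>n. X n - Y n) (\<lambda>n. X' n - Y' n)"
  using usn_equiv_add[OF assms(1) usn_equiv_minus[OF assms(2)]] by simp

lemma usn_equiv_mult:
  assumes "usn_equiv X X'" "usn_equiv Y Y'"
  shows "usn_equiv (\<lambda>n. X n * Y n) (\<lambda>n. X' n * Y' n)"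
proof -
  have C: "usn_Cauchy X" "usn_Cauchy X'" "usn_Cauchy Y" "usn_Cauchy Y'"
    using assms usn_equiv_CauchyD by blast+
  obtain B where B: "B > 0" "\<And>n. usn (X n) \<le> B" using usn_Cauchy_bounded[OF C(1)] by blast
  obtain D where D: "D > 0" "\<And>n. usn (Y' n) \<le> D" using usn_Cauchy_bounded[OF C(4)] by blast
  have "(\<lambda>n. usn (X n * Y n - X' n * Y' n)) \<longlonglongrightarrow> 0"
  proof (rule usn_null_le)
    show "(\<lambda>n. B * usn (Y n - Y' n) + usn (X n - X' n) * D) \<longlonglongrightarrow> 0"
      using assms unfolding usn_equiv_def
      by (auto intro!: tendsto_add_zero tendsto_mult_right_zero tendsto_mult_left_zero)
    show "usn (X n * Y n - X' n * Y' n) \<le> B * usn (Y n - Y' n) + usn (X n - X' n) * D" for n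
      by (rule order_trans[OF usn_mult_diff add_mono])
         (auto intro: mult_right_mono mult_left_mono B D)
  qed
  with C show ?thesis by (simp add: usn_equiv_def usn_Cauchy_mult)
qed

lemma usn_equiv_lim:
  assumes "usn_equiv X Y"
  shows "lim (\<lambda>n. usn (X n)) = lim (\<lambda>n. usn (Y n))"
proof -
  obtain a where a: "(\<lambda>n. usn (X n)) \<longlonglongrightarrow> a"
    using usn_Cauchy_real[of X] assms by (auto simp: usn_equiv_def convergent_def)
  have "(\<lambda>n. usn (X n) - usn (Y n)) \<longlonglongrightarrow> 0"
    by (rule Lim_null_comparison[of _ "\<lambda>n. usn (X n - Y n)"])
       (use assms in \<open>simp_all add: usn_abs_diff usn_equiv_def\<close>)
  from tendsto_diff[OF a this] have "(\<lambda>n. usn (Y n)) \<longlonglongrightarrow> a" by simp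
  with a show ?thesis by (simp add: limI)
qed

instantiation completion :: (cstar_seminormed) star_algebra
begin

lift_definition zero_completion :: "'a completion" is "\<lambda>n. 0"
  by (simp add: usn_equiv_refl usn_Cauchy_const)
lift_definition one_completion :: "'a completion" is "\<lambda>n. 1"
  by (simp add: usn_equiv_refl usn_Cauchy_const)
lift_definition plus_completion :: "'a completion \<Rightarrow> 'a completion \<Rightarrow> 'a completion"
  is "\<lambda>X Y n. X n + Y n" by (rule usn_equiv_add)
lift_definition minus_completion :: "'a completion \<Rightarrow> 'a completion \<Rightarrow> 'a completion"
  is "\<lambda>X Y n. X n - Y n" by (rule usn_equiv_diff)
lift_definition uminus_completion :: "'a completion \<Rightarrow> 'a completion"
  is "\<lambda>X n. - X n" by (rule usn_equiv_minus)
lift_definition times_completion :: "'a completion \<Rightarrow> 'a completion \<Rightarrow> 'a completion"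
  is "\<lambda>X Y n. X n * Y n" by (rule usn_equiv_mult)
lift_definition scaleC_completion :: "complex \<Rightarrow> 'a completion \<Rightarrow> 'a completion"
  is "\<lambda>c X n. c *\<^sub>C X n" by (rule usn_equiv_scaleC)
lift_definition star_completion :: "'a completion \<Rightarrow> 'a completion"
  is "\<lambda>X n. star (X n)" by (rule usn_equiv_star)
definition scaleR_completion :: "real \<Rightarrow> 'a completion \<Rightarrow> 'a completion"
  where "scaleR_completion r = scaleC (complex_of_real r)"

instance
proof
  show "(a + b) + c = a + (b + c)" for a b c :: "'a completion"
    by transfer (rule usn_equiv_eqI, auto simp: usn_equiv_def add.assoc intro: usn_Cauchy_add)
  show "a + b = b + a" for a b :: "'a completion"
    by transfer (rule usn_equiv_eqI, auto simp: usn_equiv_def add.commute intro: usn_Cauchy_add)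
  show "0 + a = a" for a :: "'a completion"
    by transfer (rule usn_equiv_eqI, auto simp: usn_equiv_def)
  show "- a + a = 0" for a :: "'a completion"
    by transfer (rule usn_equiv_eqI, auto simp: usn_Cauchy_const)
  show "a - b = a + - b" for a b :: "'a completion"
    by transfer (rule usn_equiv_eqI, auto simp: usn_equiv_def intro: usn_Cauchy_diff)
  show "(a * b) * c = a * (b * c)" for a b c :: "'a completion"
    by transfer (rule usn_equiv_eqI, auto simp: usn_equiv_def mult.assoc intro!: usn_Cauchy_mult)
  show "1 * a = a" for a :: "'a completion"
    by transfer (rule usn_equiv_eqI, auto simp: usn_equiv_def)
  show "a * 1 = a" for a :: "'a completion"
    by transfer (rule usn_equiv_eqI, auto simp: usn_equiv_def)
  show "(a + b) * c = a * c + b * c" for a b c :: "'a completion"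
    by transfer (rule usn_equiv_eqI,
      auto simp: usn_equiv_def distrib_right intro!: usn_Cauchy_mult usn_Cauchy_add)
  show "a * (b + c) = a * b + a * c" for a b c :: "'a completion"
    by transfer (rule usn_equiv_eqI,
      auto simp: usn_equiv_def distrib_left intro!: usn_Cauchy_mult usn_Cauchy_add)
  show "((*\<^sub>R) r :: 'a completion \<Rightarrow> _) = (*\<^sub>C) (complex_of_real r)" for r
    by (simp add: scaleR_completion_def)
  show "c *\<^sub>C (a + b) = c *\<^sub>C a + c *\<^sub>C b" for c and a b :: "'a completion"
    by transfer (rule usn_equiv_eqI,
      auto simp: usn_equiv_def scaleC_add_right intro!: usn_Cauchy_add usn_Cauchy_scaleC)
  show "(c + d) *\<^sub>C a = c *\<^sub>C a + d *\<^sub>C a" for c d and a :: "'a completion"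
    by transfer (rule usn_equiv_eqI,
      auto simp: usn_equiv_def scaleC_add_left intro!: usn_Cauchy_add usn_Cauchy_scaleC)
  show "c *\<^sub>C d *\<^sub>C a = (c * d) *\<^sub>C a" for c d and a :: "'a completion"
    by transfer (rule usn_equiv_eqI, auto simp: usn_equiv_def intro!: usn_Cauchy_scaleC)
  show "1 *\<^sub>C a = a" for a :: "'a completion"
    by transfer (rule usn_equiv_eqI, auto simp: usn_equiv_def)
  show "(c *\<^sub>C a) * b = c *\<^sub>C (a * b)" for c and a b :: "'a completion"
    by transfer (rule usn_equiv_eqI,
      auto simp: usn_equiv_def intro!: usn_Cauchy_scaleC usn_Cauchy_mult)
  show "a * (c *\<^sub>C b) = c *\<^sub>C (a * b)" for c and a b :: "'a completion"
    by transfer (rule usn_equiv_eqI,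
      auto simp: usn_equiv_def intro!: usn_Cauchy_scaleC usn_Cauchy_mult)
  show "star (star a) = a" for a :: "'a completion"
    by transfer (rule usn_equiv_eqI, auto simp: usn_equiv_def)
  show "star (a + b) = star a + star b" for a b :: "'a completion"
    by transfer (rule usn_equiv_eqI,
      auto simp: usn_equiv_def intro!: usn_Cauchy_add usn_Cauchy_star)
  show "star (c *\<^sub>C a) = cnj c *\<^sub>C star a" for c and a :: "'a completion"
    by transfer (rule usn_equiv_eqI,
      auto simp: usn_equiv_def intro!: usn_Cauchy_scaleC usn_Cauchy_star)
  show "star (a * b) = star b * star a" for a b :: "'a completion"
    by transfer (rule usn_equiv_eqI,
      auto simp: usn_equiv_def intro!: usn_Cauchy_mult usn_Cauchy_star)
qed

end

lift_definition to_completion :: "'a::cstar_seminormed \<Rightarrow> 'a completion" is "\<lambda>x n. x"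
  by (simp add: usn_equiv_refl usn_Cauchy_const)

lemma unital_star_hom_to_completion: "unital_star_hom to_completion"
  unfolding unital_star_hom_def
  by (intro conjI allI; transfer; simp add: usn_equiv_refl usn_Cauchy_const)

instantiation completion :: (cstar_seminormed) real_normed_algebra
begin

lift_definition norm_completion :: "'a completion \<Rightarrow> real" is "\<lambda>X. lim (\<lambda>n. usn (X n))"
  by (rule usn_equiv_lim)

definition dist_completion :: "'a completion \<Rightarrow> 'a completion \<Rightarrow> real"
  where "dist_completion x y = norm (x - y)"
definition sgn_completion :: "'a completion \<Rightarrow> 'a completion"
  where "sgn_completion x = x /\<^sub>R norm x"
definition uniformity_completion :: "('a completion \<times> 'a completion) filter"
  where "uniformity_completion = (INF e\<in>{0<..}. principal {(x, y). dist x y < e})"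
definition open_completion :: "'a completion set \<Rightarrow> bool"
  where "open_completion U \<longleftrightarrow> (\<forall>x\<in>U. eventually (\<lambda>(x', y). x' = x \<longrightarrow> y \<in> U) uniformity)"

lemma norm_completion_tendsto:
  assumes "usn_Cauchy X" shows "(\<lambda>n. usn (X n)) \<longlonglongrightarrow> lim (\<lambda>n. usn (X n))"
  using usn_Cauchy_real[OF assms] by (rule convergent_LIMSEQ_iff[THEN iffD1])

instance
proof
  show "dist x y = norm (x - y)" "sgn x = x /\<^sub>R norm x"
    "uniformity = (INF e\<in>{0<..}. principal {(x, y::'a completion). dist x y < e})"
    "open U \<longleftrightarrow> (\<forall>x\<in>U. eventually (\<lambda>(x', y). x' = x \<longrightarrow> y \<in> U) uniformity)"
    for x y :: "'a completion" and U :: "'a completion set"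
    by (simp_all add: dist_completion_def sgn_completion_def uniformity_completion_def
        open_completion_def)
  show "norm x = 0 \<longleftrightarrow> x = 0" for x :: "'a completion"
  proof transfer
    fix X :: "nat \<Rightarrow> 'a" assume "usn_equiv X X"
    then have X: "usn_Cauchy X" by (simp add: usn_equiv_def)
    have "usn_equiv X (\<lambda>n. 0) \<longleftrightarrow> (\<lambda>n. usn (X n)) \<longlonglongrightarrow> 0"
      by (simp add: usn_equiv_def X usn_Cauchy_const)
    also have "\<dots> \<longleftrightarrow> lim (\<lambda>n. usn (X n)) = 0"
      using norm_completion_tendsto[OF X] by (metis limI)
    finally show "lim (\<lambda>n. usn (X n)) = 0 \<longleftrightarrow> usn_equiv X (\<lambda>n. 0)" by blast
  qed
  show "norm (x + y) \<le> norm x + norm y" for x y :: "'a completion"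
  proof transfer
    fix X Y :: "nat \<Rightarrow> 'a" assume "usn_equiv X X" "usn_equiv Y Y"
    then have C: "usn_Cauchy X" "usn_Cauchy Y" by (simp_all add: usn_equiv_def)
    show "lim (\<lambda>n. usn (X n + Y n)) \<le> lim (\<lambda>n. usn (X n)) + lim (\<lambda>n. usn (Y n))"
      by (rule LIMSEQ_le[OF norm_completion_tendsto[OF usn_Cauchy_add[OF C]]
            tendsto_add[OF norm_completion_tendsto[OF C(1)] norm_completion_tendsto[OF C(2)]]])
         (simp add: usn_triangle)
  qed
  show "norm (x * y) \<le> norm x * norm y" for x y :: "'a completion"
  proof transfer
    fix X Y :: "nat \<Rightarrow> 'a" assume "usn_equiv X X" "usn_equiv Y Y"
    then have C: "usn_Cauchy X" "usn_Cauchy Y" by (simp_all add: usn_equiv_def)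
    show "lim (\<lambda>n. usn (X n * Y n)) \<le> lim (\<lambda>n. usn (X n)) * lim (\<lambda>n. usn (Y n))"
      by (rule LIMSEQ_le[OF norm_completion_tendsto[OF usn_Cauchy_mult[OF C]]
            tendsto_mult[OF norm_completion_tendsto[OF C(1)] norm_completion_tendsto[OF C(2)]]])
         (simp add: usn_mult)
  qed
  show "norm (r *\<^sub>R x) = \<bar>r\<bar> * norm x" for r and x :: "'a completion"
    unfolding scaleR_scaleC
  proof transfer
    fix r and X :: "nat \<Rightarrow> 'a" assume "usn_equiv X X"
    then have X: "usn_Cauchy X" by (simp add: usn_equiv_def)
    show "lim (\<lambda>n. usn (complex_of_real r *\<^sub>C X n)) = \<bar>r\<bar> * lim (\<lambda>n. usn (X n))"
      using tendsto_mult_left[OF norm_completion_tendsto[OF X], of "\<bar>r\<bar>"]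
      by (simp add: usn_scaleC limI)
  qed
qed

end

lemma norm_to_completion: "norm (to_completion x) = usn x"
  by transfer simp

lemma to_completion_diff: "to_completion (x - y) = to_completion x - to_completion y"
  by transfer (simp add: usn_equiv_refl usn_Cauchy_const)

lemma tendsto_to_completion:
  fixes X :: "nat \<Rightarrow> 'a::cstar_seminormed"
  assumes X: "usn_Cauchy X"
  shows "(\<lambda>n. to_completion (X n)) \<longlonglongrightarrow> abs_completion X"
proof (rule metric_LIMSEQ_I)
  fix e :: real assume "e > 0"
  then obtain N where N: "\<And>m n. m \<ge> N \<Longrightarrow> n \<ge> N \<Longrightarrow> usn (X m - X n) < e / 2"
    using X unfolding usn_Cauchy_def by (meson half_gt_zero)
  have "dist (to_completion (X n)) (abs_completion X) < e" if n: "n \<ge> N" for n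
  proof -
    have c: "usn_Cauchy (\<lambda>m. X n - X m)" by (intro usn_Cauchy_diff usn_Cauchy_const X)
    have "dist (to_completion (X n)) (abs_completion X) = lim (\<lambda>m. usn (X n - X m))"
      by (simp add: dist_completion_def to_completion.abs_eq minus_completion.abs_eq
          norm_completion.abs_eq usn_equiv_refl usn_Cauchy_const X c)
    also have "\<dots> \<le> e / 2"
      by (rule LIMSEQ_le_const2[OF norm_completion_tendsto[OF c]])
         (use N n in \<open>auto intro!: exI[of _ N] less_imp_le\<close>)
    finally show ?thesis using \<open>e > 0\<close> by simp
  qed
  then show "\<exists>N. \<forall>n\<ge>N. dist (to_completion (X n)) (abs_completion X) < e" by blast
qed

lemma to_completion_dense: "closure (range (to_completion :: 'a::cstar_seminormed \<Rightarrow> _)) = UNIV"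
proof -
  have "z \<in> closure (range (to_completion :: 'a \<Rightarrow> _))" for z
  proof (induction z rule: completion.abs_induct)
    case (1 X)
    then have "(\<lambda>n. to_completion (X n)) \<longlonglongrightarrow> abs_completion X"
      by (intro tendsto_to_completion) (simp add: usn_equiv_def)
    then show ?case
      by (rule closed_sequentially[OF closed_closure, rotated])
         (rule subsetD[OF closure_subset rangeI])
  qed
  then show ?thesis by blast
qed

instance completion :: (cstar_seminormed) cstar_algebra
proof
  show "norm (c *\<^sub>C x) = cmod c * norm x" for c and x :: "'a completion"
  proof transfer
    fix c and X :: "nat \<Rightarrow> 'a" assume "usn_equiv X X"
    then have X: "usn_Cauchy X" by (simp add: usn_equiv_def)
    show "lim (\<lambda>n. usn (c *\<^sub>C X n)) = cmod c * lim (\<lambda>n. usn (X n))"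
      using tendsto_mult_left[OF norm_completion_tendsto[OF X], of "cmod c"]
      by (simp add: usn_scaleC limI)
  qed
  show "norm (star x * x) = (norm x)\<^sup>2" for x :: "'a completion"
  proof transfer
    fix X :: "nat \<Rightarrow> 'a" assume "usn_equiv X X"
    then have X: "usn_Cauchy X" by (simp add: usn_equiv_def)
    show "lim (\<lambda>n. usn (star (X n) * X n)) = (lim (\<lambda>n. usn (X n)))\<^sup>2"
      using tendsto_power[OF norm_completion_tendsto[OF X], of 2]
      by (simp add: usn_star_mult limI)
  qed
  fix Z :: "nat \<Rightarrow> 'a completion" assume Z: "Cauchy Z"
  have "\<exists>x. dist (to_completion x) (Z n) < inverse (real (Suc n))" for n
    using to_completion_dense[where 'a='a]
    by (metis (mono_tags, lifting) UNIV_I closure_approachable imageE inverse_positive_iff_positive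
        of_nat_0_less_iff zero_less_Suc)
  then obtain X where X: "\<And>n. dist (to_completion (X n)) (Z n) < inverse (real (Suc n))"
    by metis
  have lim0: "(\<lambda>n. dist (to_completion (X n)) (Z n)) \<longlonglongrightarrow> 0"
    by (rule tendsto_sandwich[OF _ _ tendsto_const LIMSEQ_inverse_real_of_nat])
       (rule always_eventually; rule allI; rule zero_le_dist less_imp_le[OF X])+
  have "usn_Cauchy X"
    unfolding usn_Cauchy_def
  proof (intro allI impI)
    fix e :: real assume "e > 0"
    then have e: "e / 3 > 0" by simp
    obtain N1 where N1: "\<And>m n. m \<ge> N1 \<Longrightarrow> n \<ge> N1 \<Longrightarrow> dist (Z m) (Z n) < e / 3"
      using metric_CauchyD[OF Z e] by blast
    obtain N2 where N2: "\<And>n. n \<ge> N2 \<Longrightarrow> dist (to_completion (X n)) (Z n) < e / 3"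
      using metric_LIMSEQ_D[OF lim0 e] by auto
    have "usn (X m - X n) < e" if "m \<ge> max N1 N2" "n \<ge> max N1 N2" for m n
    proof -
      have "usn (X m - X n) = dist (to_completion (X m)) (to_completion (X n))"
        by (simp add: dist_norm norm_to_completion flip: to_completion_diff)
      also have "\<dots> \<le> dist (to_completion (X m)) (Z m) + (dist (Z m) (Z n) + dist (Z n) (to_completion (X n)))"
        by (meson add_left_mono dist_triangle order_trans)
      also have "\<dots> < e"
        using N1[of m n] N2[of m] N2[of n] that by (simp add: dist_commute)
      finally show ?thesis .
    qed
    then show "\<exists>N. \<forall>m\<ge>N. \<forall>n\<ge>N. usn (X m - X n) < e" by blast
  qed
  then have "(\<lambda>n. to_completion (X n)) \<longlonglongrightarrow> abs_completion X"
    by (rule tendsto_to_completion)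
  moreover have "(\<lambda>n. Z n - to_completion (X n)) \<longlonglongrightarrow> 0"
    by (rule tendsto_norm_zero_cancel) (use lim0 in \<open>simp add: dist_norm norm_minus_commute\<close>)
  ultimately have "Z \<longlonglongrightarrow> abs_completion X"
    by (rule Lim_transform)
  then show "convergent Z" by (auto simp: convergent_def)
qed


section \<open>Monoid *-algebras and universal C*-algebras\<close>

class star_monoid = monoid_mult + star +
  assumes star_monoid_star [simp]: "star (star x) = x"
    and star_monoid_mult [simp]: "star (x * y) = star y * star x"

typedef 'm malg = "{f :: 'm \<Rightarrow> complex. finite {m. f m \<noteq> 0}}"
  morphisms coef Abs_malg
  by (rule exI[of _ "\<lambda>_. 0"]) simp

setup_lifting type_definition_malg

lift_definition single :: "'m \<Rightarrow> 'm malg" is "\<lambda>m k. if k = m then 1 else 0"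
  by simp

definition supp :: "'m malg \<Rightarrow> 'm set" where
  "supp f = {m. coef f m \<noteq> 0}"

lemma finite_supp [simp]: "finite (supp f)"
  unfolding supp_def by transfer simp

lemma malg_eqI: "(\<And>m. coef f m = coef g m) \<Longrightarrow> f = g"
  by (metis coef_inject ext)

instantiation malg :: (type) complex_vector
begin

lift_definition zero_malg :: "'a malg" is "\<lambda>_. 0" by simp
lift_definition plus_malg :: "'a malg \<Rightarrow> 'a malg \<Rightarrow> 'a malg" is "\<lambda>f g m. f m + g m"
proof -
  fix f g :: "'a \<Rightarrow> complex" assume "finite {m. f m \<noteq> 0}" "finite {m. g m \<noteq> 0}"
  then have "finite ({m. f m \<noteq> 0} \<union> {m. g m \<noteq> 0})" by simp
  then show "finite {m. f m + g m \<noteq> 0}" by (rule rev_finite_subset) auto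
qed
lift_definition minus_malg :: "'a malg \<Rightarrow> 'a malg \<Rightarrow> 'a malg" is "\<lambda>f g m. f m - g m"
proof -
  fix f g :: "'a \<Rightarrow> complex" assume "finite {m. f m \<noteq> 0}" "finite {m. g m \<noteq> 0}"
  then have "finite ({m. f m \<noteq> 0} \<union> {m. g m \<noteq> 0})" by simp
  then show "finite {m. f m - g m \<noteq> 0}" by (rule rev_finite_subset) auto
qed
lift_definition uminus_malg :: "'a malg \<Rightarrow> 'a malg" is "\<lambda>f m. - f m"
  by simp
lift_definition scaleC_malg :: "complex \<Rightarrow> 'a malg \<Rightarrow> 'a malg" is "\<lambda>c f m. c * f m"
  by (erule rev_finite_subset) auto
definition scaleR_malg :: "real \<Rightarrow> 'a malg \<Rightarrow> 'a malg"
  where "scaleR_malg r = scaleC (complex_of_real r)"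

instance
  by standard (simp add: scaleR_malg_def | transfer, force simp: algebra_simps)+

end

lemma coef_simps [simp]:
  "coef 0 m = 0" "coef (f + g) m = coef f m + coef g m" "coef (f - g) m = coef f m - coef g m"
  "coef (- f) m = - coef f m" "coef (c *\<^sub>C f) m = c * coef f m"
  "coef (single k) m = (if m = k then 1 else 0)"
  by (transfer; simp)+

definition lin_ext :: "('m \<Rightarrow> 'v::complex_vector) \<Rightarrow> 'm malg \<Rightarrow> 'v" where
  "lin_ext F f = (\<Sum>m\<in>supp f. coef f m *\<^sub>C F m)"

lemma lin_ext_superset:
  assumes "finite S" "supp f \<subseteq> S"
  shows "lin_ext F f = (\<Sum>m\<in>S. coef f m *\<^sub>C F m)"
  unfolding lin_ext_def by (rule sum.mono_neutral_left) (use assms in \<open>auto simp: supp_def\<close>)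

lemma lin_ext_single [simp]: "lin_ext F (single m) = F m"
  by (subst lin_ext_superset[of "{m}"]) (auto simp: supp_def split: if_splits)

lemma lin_ext_add [simp]: "lin_ext F (f + g) = lin_ext F f + lin_ext F g"
proof -
  have S: "finite (supp f \<union> supp g)" by simp
  show ?thesis
    by (subst (1 2 3) lin_ext_superset[OF S])
       (auto simp: supp_def scaleC_add_left sum.distrib)
qed

lemma lin_ext_scaleC [simp]: "lin_ext F (c *\<^sub>C f) = c *\<^sub>C lin_ext F f"
  by (subst (1 2) lin_ext_superset[OF finite_supp[of f]])
     (auto simp: supp_def scaleC_sum_right)

lemma lin_ext_fun_add: "lin_ext (\<lambda>m. F m + G m) f = lin_ext F f + lin_ext G f"
  by (simp add: lin_ext_def scaleC_add_right sum.distrib)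

lemma lin_ext_fun_scaleC: "lin_ext (\<lambda>m. c *\<^sub>C F m) f = c *\<^sub>C lin_ext F f"
  by (simp add: lin_ext_def scaleC_sum_right mult.commute)

lemma malg_expand: "f = (\<Sum>m\<in>supp f. coef f m *\<^sub>C single m)"
proof (rule malg_eqI)
  fix k
  have "coef (sum g S) k = (\<Sum>m\<in>S. coef (g m) k)" for g :: "'a \<Rightarrow> 'a malg" and S
    by (induction S rule: infinite_finite_induct) simp_all
  then show "coef f k = coef (\<Sum>m\<in>supp f. coef f m *\<^sub>C single m) k"
    by (simp add: if_distrib sum.delta cong: if_cong) (simp add: supp_def)
qed

lemma malg_induct [case_names single add scaleC]:
  assumes "\<And>m. P (single m)" "\<And>f g. P f \<Longrightarrow> P g \<Longrightarrow> P (f + g)" "\<And>c f. P f \<Longrightarrow> P (c *\<^sub>C f)"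
  shows "P f"
proof -
  have "P 0" using assms(3)[OF assms(1), of 0] by simp
  then have "P (\<Sum>m\<in>S. coef f m *\<^sub>C single m)" for S
    by (induction S rule: infinite_finite_induct) (simp_all add: assms)
  then show ?thesis by (subst malg_expand)
qed

instantiation malg :: (star_monoid) star_algebra
begin

definition one_malg :: "'a malg" where "one_malg = single 1"

text \<open>Convolution: the bilinear extension of the multiplication of the monoid.\<close>

definition times_malg :: "'a malg \<Rightarrow> 'a malg \<Rightarrow> 'a malg" where
  "times_malg f g = lin_ext (\<lambda>u. lin_ext (\<lambda>v. single (u * v)) g) f"

text \<open>Since \<open>star\<close> is an involution of the monoid, this is the conjugate-linear extension of
  \<open>single m \<mapsto> single (star m)\<close>.\<close>

lift_definition star_malg :: "'a malg \<Rightarrow> 'a malg" is "\<lambda>f m. cnj (f (star m))"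
proof -
  fix f :: "'a \<Rightarrow> complex" assume "finite {m. f m \<noteq> 0}"
  then have "finite (star ` {m. f m \<noteq> 0})" by simp
  then show "finite {m. cnj (f (star m)) \<noteq> 0}"
    by (rule rev_finite_subset) (force simp: image_iff intro: star_monoid_star[symmetric])
qed

lemma times_malg_single: "single u * single v = (single (u * v) :: 'a malg)"
  by (simp add: times_malg_def)

lemma coef_star: "coef (star f) m = cnj (coef f (star m))" for f :: "'a malg"
  by transfer simp

lemma star_malg_single: "star (single m) = (single (star m) :: 'a malg)"
  by (rule malg_eqI) (auto simp: coef_star)

instance
proof
  fix f g h :: "'a malg" and c :: complex
  show dr: "(f + g) * h = f * h + g * h" for f g h :: "'a malg"
    by (simp add: times_malg_def)
  show dl: "f * (g + h) = f * g + f * h" for f g h :: "'a malg"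
    by (simp add: times_malg_def lin_ext_fun_add)
  show sl: "(c *\<^sub>C f) * g = c *\<^sub>C (f * g)" for c and f g :: "'a malg"
    by (simp add: times_malg_def)
  show sr: "f * (c *\<^sub>C g) = c *\<^sub>C (f * g)" for c and f g :: "'a malg"
    by (simp add: times_malg_def lin_ext_fun_scaleC)
  have assoc1: "single u * single v * h = single u * (single v * h)" for u v and h :: "'a malg"
    by (induction h rule: malg_induct) (simp_all add: dr dl sl sr times_malg_single mult.assoc)
  have assoc2: "single u * g * h = single u * (g * h)" for u and g h :: "'a malg"
    by (induction g rule: malg_induct) (simp_all add: dr dl sl sr assoc1)
  show "f * g * h = f * (g * h)"
    by (induction f rule: malg_induct) (simp_all add: dr dl sl sr assoc2)
  show "1 * f = f"
    by (induction f rule: malg_induct) (simp_all add: dr dl sl sr one_malg_def times_malg_single)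
  show "f * 1 = f"
    by (induction f rule: malg_induct) (simp_all add: dr dl sl sr one_malg_def times_malg_single)
  show "star (star f) = f"
    by (rule malg_eqI) (simp add: coef_star)
  show sa: "star (f + g) = star f + star g" for f g :: "'a malg"
    by (rule malg_eqI) (simp add: coef_star)
  show sc: "star (c *\<^sub>C f) = cnj c *\<^sub>C star f" for c and f :: "'a malg"
    by (rule malg_eqI) (simp add: coef_star)
  have sm: "star (single u * g) = star g * star (single u)" for u and g :: "'a malg"
    by (induction g rule: malg_induct)
       (simp_all add: dr dl sl sr sa sc star_malg_single times_malg_single)
  show "star (f * g) = star g * star f"
    by (induction f rule: malg_induct) (simp_all add: dr dl sl sr sa sc sm)
qed

end

class presented_star_monoid = star_monoid +
  fixes rels :: "'a malg set"

definition admissible :: "('m::presented_star_monoid malg \<Rightarrow> real) \<Rightarrow> bool" where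
  "admissible p \<longleftrightarrow> cstar_seminorm p \<and> (\<forall>r\<in>rels. p r = 0)"

text \<open>The C*-seminorms vanishing on the relators are the C*-seminorms on the quotient of the
  monoid *-algebra by the *-ideal generated by them; their supremum is the seminorm of the universal
  C*-algebra. The value 0 is used only if the supremum is infinite; \<open>bounded_fword\<close> and
  \<open>bounded_tpair\<close> below show that this does not happen for free products
  and for tensor products.\<close>

definition seminorms_bounded :: "'m::presented_star_monoid itself \<Rightarrow> bool" where
  "seminorms_bounded _ \<longleftrightarrow> (\<forall>f :: 'm malg. bdd_above {p f |p. admissible p})"

instantiation malg :: (presented_star_monoid) cstar_seminormed
begin

definition usn_malg :: "'a malg \<Rightarrow> real" where
  "usn_malg f = (if seminorms_bounded TYPE('a) then Sup {p f |p. admissible p} else 0)"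

instance
proof
  show "cstar_seminorm (usn :: 'a malg \<Rightarrow> real)"
  proof (cases "seminorms_bounded TYPE('a)")
    case False
    then show ?thesis by (simp add: cstar_seminorm_def usn_malg_def)
  next
    case True
    have csn: "cstar_seminorm p" if "admissible p" for p :: "'a malg \<Rightarrow> real"
      using that by (simp add: admissible_def)
    have ne: "admissible (\<lambda>f :: 'a malg. 0)"
      by (simp add: admissible_def cstar_seminorm_def)
    have upper: "p f \<le> usn f" if "admissible p" for p and f :: "'a malg"
      using True that by (auto simp: usn_malg_def seminorms_bounded_def intro!: cSup_upper)
    have least: "usn f \<le> B" if "\<And>p. admissible p \<Longrightarrow> p f \<le> B" for f :: "'a malg" and B
      using True that ne by (auto simp: usn_malg_def intro!: cSup_least)
    have nonneg: "0 \<le> usn f" for f :: "'a malg"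
      using upper[OF ne] by simp
    have add: "usn (f + g) \<le> usn f + usn g" for f g :: "'a malg"
      by (rule least) (meson csn csn_triangle upper add_mono order_trans)
    have scale_le: "usn (c *\<^sub>C f) \<le> cmod c * usn f" for c and f :: "'a malg"
      by (rule least) (simp add: csn_scaleC[OF csn] upper mult_left_mono)
    have scale: "usn (c *\<^sub>C f) = cmod c * usn f" for c and f :: "'a malg"
    proof (cases "c = 0")
      case True
      then show ?thesis using scale_le[of 0 f] nonneg[of 0] by simp
    next
      case False
      have "usn f = usn (inverse c *\<^sub>C c *\<^sub>C f)" using False by simp
      also have "\<dots> \<le> cmod (inverse c) * usn (c *\<^sub>C f)" by (rule scale_le)
      finally show ?thesis using False scale_le[of c f] by (simp add: norm_inverse norm_divide field_simps)
    qed
    have mult: "usn (f * g) \<le> usn f * usn g" for f g :: "'a malg"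
      by (rule least, rule order_trans[OF csn_mult[OF csn]])
         (auto intro!: mult_mono upper csn_nonneg[OF csn] nonneg)
    have cstar: "usn (star f * f) = (usn f)\<^sup>2" for f :: "'a malg"
    proof (rule antisym)
      show "usn (star f * f) \<le> (usn f)\<^sup>2"
        by (rule least) (auto simp: csn_star_mult[OF csn] intro!: power_mono upper csn_nonneg[OF csn])
      have "usn f \<le> sqrt (usn (star f * f))"
        by (rule least, rule real_le_rsqrt) (metis csn csn_star_mult upper)
      then show "(usn f)\<^sup>2 \<le> usn (star f * f)"
        using nonneg by (metis power_mono real_sqrt_pow2)
    qed
    show ?thesis by (simp add: cstar_seminorm_def add scale mult cstar)
  qed
qed

end

lemma seminorms_boundedI:
  assumes "\<And>m :: 'm::presented_star_monoid. \<exists>K. \<forall>p. admissible p \<longrightarrow> p (single m) \<le> K"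
  shows "seminorms_bounded TYPE('m)"
proof -
  have "\<exists>K. \<forall>p. admissible p \<longrightarrow> p f \<le> K" for f :: "'m malg"
  proof (induction f rule: malg_induct)
    case (add f g)
    then obtain K L where "\<forall>p. admissible p \<longrightarrow> p f \<le> K" "\<forall>p. admissible p \<longrightarrow> p g \<le> L" by blast
    then show ?case
      by (intro exI[of _ "K + L"]) (meson admissible_def csn_triangle add_mono order_trans)
  next
    case (scaleC c f)
    then obtain K where "\<forall>p. admissible p \<longrightarrow> p f \<le> K" by blast
    then show ?case
      by (intro exI[of _ "cmod c * K"]) (auto simp: admissible_def csn_scaleC mult_left_mono)
  qed (rule assms)
  then show ?thesis by (fastforce simp: seminorms_bounded_def bdd_above_def)
qed

lemma admissible_le_usn:
  assumes "seminorms_bounded TYPE('m::presented_star_monoid)" "admissible p"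
  shows "p f \<le> usn (f :: 'm malg)"
  using assms by (auto simp: usn_malg_def seminorms_bounded_def intro!: cSup_upper)

lemma usn_rel: "r \<in> rels \<Longrightarrow> usn (r :: 'm::presented_star_monoid malg) = 0"
proof (cases "seminorms_bounded TYPE('m)")
  case True
  assume r: "r \<in> rels"
  have "admissible (\<lambda>f :: 'm malg. 0)" by (simp add: admissible_def cstar_seminorm_def)
  then have "{p r |p. admissible p} = {0}" using r by (auto simp: admissible_def)
  then show ?thesis by (simp add: usn_malg_def)
qed (simp add: usn_malg_def)

lemma to_completion_rel: "r \<in> rels \<Longrightarrow> to_completion (r :: 'm::presented_star_monoid malg) = 0"
  using norm_to_completion[of r] by (simp add: usn_rel)


section \<open>Free products amalgamated over the unit\<close>

text \<open>Words in the disjoint union of copies, indexed by \<open>'x\<close>, of a C*-algebra \<open>'c\<close>. The relators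
  say that each copy is embedded by a unital *-homomorphism; compatibility with \<open>star\<close> is already
  built into the involution on words.\<close>

datatype ('x, 'c) fword = FWord (letters: "('x \<times> 'c) list")

instantiation fword :: (type, star_algebra) star_monoid
begin

definition one_fword :: "('a, 'b) fword" where "one_fword = FWord []"
definition times_fword :: "('a, 'b) fword \<Rightarrow> ('a, 'b) fword \<Rightarrow> ('a, 'b) fword" where
  "times_fword u v = FWord (letters u @ letters v)"
definition star_fword :: "('a, 'b) fword \<Rightarrow> ('a, 'b) fword" where
  "star_fword u = FWord (rev (map (\<lambda>(x, c). (x, star c)) (letters u)))"

instance
  by standard
     (auto simp: one_fword_def times_fword_def star_fword_def rev_map comp_def split_def
        intro!: fword.expand map_idI)

end

abbreviation letter :: "'x \<Rightarrow> 'c::star_algebra \<Rightarrow> ('x, 'c) fword malg" where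
  "letter x c \<equiv> single (FWord [(x, c)])"

instantiation fword :: (type, cstar_algebra) presented_star_monoid
begin

definition rels_fword :: "('a, 'b) fword malg set" where
  "rels_fword =
     {letter x (c + d) - (letter x c + letter x d) |x c d. True} \<union>
     {letter x (k *\<^sub>C c) - k *\<^sub>C letter x c |x k c. True} \<union>
     {letter x (c * d) - letter x c * letter x d |x c d. True} \<union>
     {letter x 1 - 1 |x. True}"

instance ..

end

type_synonym ('x, 'c) free_product = "('x, 'c) fword malg completion"

definition free_in :: "'x \<Rightarrow> 'c::cstar_algebra \<Rightarrow> ('x, 'c) free_product" where
  "free_in x c = to_completion (letter x c)"

lemma fword_rels:
  "letter x (c + d) - (letter x c + letter x d) \<in> rels"
  "letter x (k *\<^sub>C c) - k *\<^sub>C letter x c \<in> rels"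
  "letter x (c * d) - letter x c * letter x d \<in> rels"
  "letter x 1 - 1 \<in> rels"
  unfolding rels_fword_def by blast+

lemma csn_zero_eq:
  assumes "cstar_seminorm p" "p (f - g) = 0" shows "p f = p g"
  using csn_abs_diff[OF assms(1), of f g] assms(2) by simp

lemma bounded_fword: "seminorms_bounded TYPE(('x, 'c::cstar_algebra) fword)"
proof (rule seminorms_boundedI)
  fix m :: "('x, 'c) fword"
  have letter: "p (letter x c) \<le> norm c" if adm: "admissible p"
    for p :: "('x, 'c) fword malg \<Rightarrow> real" and x c
  proof -
    have p: "cstar_seminorm p" and r: "\<And>r. r \<in> rels \<Longrightarrow> p r = 0"
      using adm by (auto simp: admissible_def)
    have 1: "p (letter x (c + d)) = p (letter x c + letter x d)" for c d
      by (rule csn_zero_eq[OF p], rule r, rule fword_rels)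
    have 2: "p (letter x (k *\<^sub>C c)) = p (k *\<^sub>C letter x c)" for k c
      by (rule csn_zero_eq[OF p], rule r, rule fword_rels)
    have 3: "p (letter x (c * d)) = p (letter x c * letter x d)" for c d
      by (rule csn_zero_eq[OF p], rule r, rule fword_rels)
    have 4: "letter x (star c) = star (letter x c)" for c
      by (simp add: star_malg_single star_fword_def)
    have "cstar_seminorm (\<lambda>c. p (letter x c))"
      by (simp add: cstar_seminorm_def 1 2 3 4 csn_triangle[OF p] csn_scaleC[OF p] csn_mult[OF p]
          csn_star_mult[OF p])
    then show ?thesis by (rule cstar_seminorm_le_norm)
  qed
  have "p (single (FWord w)) \<le> (\<Prod>(x, c)\<leftarrow>w. norm c)" if adm: "admissible p"
    for p :: "('x, 'c) fword malg \<Rightarrow> real" and w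
  proof (induction w)
    case Nil
    then show ?case using adm csn_one[of p] by (simp add: admissible_def one_malg_def one_fword_def)
  next
    case (Cons a w)
    obtain x c where a: "a = (x, c)" by fastforce
    have p: "cstar_seminorm p" using adm by (simp add: admissible_def)
    have "p (single (FWord (a # w))) = p (letter x c * single (FWord w))"
      by (simp add: times_malg_single times_fword_def a)
    also have "\<dots> \<le> p (letter x c) * p (single (FWord w))" by (rule csn_mult[OF p])
    also have "\<dots> \<le> norm c * (\<Prod>(x, c)\<leftarrow>w. norm c)"
      by (rule mult_mono[OF letter[OF adm] Cons]) (simp_all add: csn_nonneg[OF p])
    finally show ?case by (simp add: a)
  qed
  then show "\<exists>K. \<forall>p. admissible p \<longrightarrow> p (single m) \<le> K"
    by (metis fword.collapse)
qed

lemma unital_star_hom_free_in: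
  "unital_star_hom (free_in x :: 'c::cstar_algebra \<Rightarrow> ('x, 'c) free_product)"
proof -
  note t = unital_star_hom_to_completion[unfolded unital_star_hom_def, where ?'a = "('x, 'c) fword malg"]
  have ta: "to_completion (f + g) = to_completion f + to_completion g"
    and ts: "to_completion (k *\<^sub>C f) = k *\<^sub>C to_completion f"
    and tm: "to_completion (f * g) = to_completion f * to_completion g"
    and tst: "to_completion (star f) = star (to_completion f)"
    and t1: "to_completion (1 :: ('x, 'c) fword malg) = 1"
    for f g :: "('x, 'c) fword malg" and k
    using t by blast+
  have eq: "to_completion f = to_completion g" if "f - g \<in> rels" for f g :: "('x, 'c) fword malg"
    using to_completion_rel[OF that] by (simp add: to_completion_diff)
  have "free_in x (c + d) = free_in x c + free_in x d" for c d :: 'c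
    unfolding free_in_def ta[symmetric]
    by (rule eq, rule fword_rels)
  moreover have "free_in x (k *\<^sub>C c) = k *\<^sub>C free_in x c" for k and c :: 'c
    unfolding free_in_def ts[symmetric]
    by (rule eq, rule fword_rels)
  moreover have "free_in x (c * d) = free_in x c * free_in x d" for c d :: 'c
    unfolding free_in_def tm[symmetric]
    by (rule eq, rule fword_rels)
  moreover have "free_in x (star c) = star (free_in x c)" for c :: 'c
    unfolding free_in_def tst[symmetric] by (simp add: star_malg_single star_fword_def)
  moreover have "free_in x (1 :: 'c) = 1"
    unfolding free_in_def t1[symmetric] by (rule eq, rule fword_rels)
  ultimately show ?thesis by (simp add: unital_star_hom_def)
qed


section \<open>The maximal tensor product\<close>

text \<open>The quotient of the monoid *-algebra of \<open>'c \<times> 'd\<close> by the bilinearity relators is the algebraic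
  tensor product.\<close>

datatype ('c, 'd) tpair = TPair (tfst: 'c) (tsnd: 'd)

instantiation tpair :: (star_algebra, star_algebra) star_monoid
begin

definition one_tpair :: "('a, 'b) tpair" where "one_tpair = TPair 1 1"
definition times_tpair :: "('a, 'b) tpair \<Rightarrow> ('a, 'b) tpair \<Rightarrow> ('a, 'b) tpair" where
  "times_tpair u v = TPair (tfst u * tfst v) (tsnd u * tsnd v)"
definition star_tpair :: "('a, 'b) tpair \<Rightarrow> ('a, 'b) tpair" where
  "star_tpair u = TPair (star (tfst u)) (star (tsnd u))"

instance
  by standard (simp_all add: one_tpair_def times_tpair_def star_tpair_def mult.assoc)

end

abbreviation ptensor :: "'c::star_algebra \<Rightarrow> 'd::star_algebra \<Rightarrow> ('c, 'd) tpair malg" where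
  "ptensor c d \<equiv> single (TPair c d)"

instantiation tpair :: (cstar_algebra, cstar_algebra) presented_star_monoid
begin

definition rels_tpair :: "('a, 'b) tpair malg set" where
  "rels_tpair =
     {ptensor (c + c') d - (ptensor c d + ptensor c' d) |c c' d. True} \<union>
     {ptensor c (d + d') - (ptensor c d + ptensor c d') |c d d'. True} \<union>
     {ptensor (k *\<^sub>C c) d - k *\<^sub>C ptensor c d |k c d. True} \<union>
     {ptensor c (k *\<^sub>C d) - k *\<^sub>C ptensor c d |k c d. True}"

instance ..

end

type_synonym ('c, 'd) max_tensor = "('c, 'd) tpair malg completion"

definition tensor :: "'c::cstar_algebra \<Rightarrow> 'd::cstar_algebra \<Rightarrow> ('c, 'd) max_tensor"
    (infixr \<open>\<otimes>\<^sub>m\<close> 75) where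
  "c \<otimes>\<^sub>m d = to_completion (ptensor c d)"

lemma tpair_rels:
  "ptensor (c + c') d - (ptensor c d + ptensor c' d) \<in> rels"
  "ptensor c (d + d') - (ptensor c d + ptensor c d') \<in> rels"
  "ptensor (k *\<^sub>C c) d - k *\<^sub>C ptensor c d \<in> rels"
  "ptensor c (k *\<^sub>C d) - k *\<^sub>C ptensor c d \<in> rels"
  unfolding rels_tpair_def by blast+

lemma bounded_tpair: "seminorms_bounded TYPE(('c::cstar_algebra, 'd::cstar_algebra) tpair)"
proof (rule seminorms_boundedI)
  fix m :: "('c, 'd) tpair"
  obtain a b where m: "m = TPair a b" by (cases m)
  have "p (single m) \<le> norm a * norm b" if adm: "admissible p"
    for p :: "('c, 'd) tpair malg \<Rightarrow> real"
  proof -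
    have p: "cstar_seminorm p" and r: "\<And>r. r \<in> rels \<Longrightarrow> p r = 0"
      using adm by (auto simp: admissible_def)
    have 1: "p (ptensor (c + c') d) = p (ptensor c d + ptensor c' d)" for c c' d
      by (rule csn_zero_eq[OF p], rule r, rule tpair_rels)
    have 2: "p (ptensor c (d + d')) = p (ptensor c d + ptensor c d')" for c d d'
      by (rule csn_zero_eq[OF p], rule r, rule tpair_rels)
    have 3: "p (ptensor (k *\<^sub>C c) d) = p (k *\<^sub>C ptensor c d)" for k c d
      by (rule csn_zero_eq[OF p], rule r, rule tpair_rels)
    have 4: "p (ptensor c (k *\<^sub>C d)) = p (k *\<^sub>C ptensor c d)" for k c d
      by (rule csn_zero_eq[OF p], rule r, rule tpair_rels)
    have 5: "ptensor (c * c') 1 = ptensor c 1 * (ptensor c' 1 :: ('c, 'd) tpair malg)" for c c'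
      by (simp add: times_malg_single times_tpair_def)
    have 6: "ptensor 1 (d * d') = ptensor 1 d * (ptensor 1 d' :: ('c, 'd) tpair malg)" for d d'
      by (simp add: times_malg_single times_tpair_def)
    have 7: "ptensor (star c) 1 = star (ptensor c 1 :: ('c, 'd) tpair malg)" for c
      by (simp add: star_malg_single star_tpair_def)
    have 8: "ptensor 1 (star d) = star (ptensor 1 d :: ('c, 'd) tpair malg)" for d
      by (simp add: star_malg_single star_tpair_def)
    have "cstar_seminorm (\<lambda>c. p (ptensor c 1))"
      by (simp add: cstar_seminorm_def 1 3 5 7 csn_triangle[OF p] csn_scaleC[OF p] csn_mult[OF p]
          csn_star_mult[OF p])
    then have a: "p (ptensor a 1) \<le> norm a" by (rule cstar_seminorm_le_norm)
    have "cstar_seminorm (\<lambda>d. p (ptensor 1 d))"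
      by (simp add: cstar_seminorm_def 2 4 6 8 csn_triangle[OF p] csn_scaleC[OF p] csn_mult[OF p]
          csn_star_mult[OF p])
    then have b: "p (ptensor 1 b) \<le> norm b" by (rule cstar_seminorm_le_norm)
    have "p (single m) = p (ptensor a 1 * ptensor 1 b)"
      by (simp add: m times_malg_single times_tpair_def)
    also have "\<dots> \<le> p (ptensor a 1) * p (ptensor 1 b)" by (rule csn_mult[OF p])
    also have "\<dots> \<le> norm a * norm b"
      by (rule mult_mono[OF a b]) (simp_all add: csn_nonneg[OF p])
    finally show ?thesis .
  qed
  then show "\<exists>K. \<forall>p. admissible p \<longrightarrow> p (single m) \<le> K" by blast
qed

lemma
  fixes c c' :: "'c::cstar_algebra" and d d' :: "'d::cstar_algebra"
  shows tensor_add_left: "(c + c') \<otimes>\<^sub>m d = c \<otimes>\<^sub>m d + c' \<otimes>\<^sub>m d"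
    and tensor_add_right: "c \<otimes>\<^sub>m (d + d') = c \<otimes>\<^sub>m d + c \<otimes>\<^sub>m d'"
    and tensor_scaleC_left: "(k *\<^sub>C c) \<otimes>\<^sub>m d = k *\<^sub>C (c \<otimes>\<^sub>m d)"
    and tensor_scaleC_right: "c \<otimes>\<^sub>m (k *\<^sub>C d) = k *\<^sub>C (c \<otimes>\<^sub>m d)"
    and tensor_mult: "(c \<otimes>\<^sub>m d) * (c' \<otimes>\<^sub>m d') = (c * c') \<otimes>\<^sub>m (d * d')"
    and tensor_star: "star (c \<otimes>\<^sub>m d) = star c \<otimes>\<^sub>m star d"
    and tensor_one: "(1 :: 'c) \<otimes>\<^sub>m (1 :: 'd) = 1"
proof -
  note t = unital_star_hom_to_completion[unfolded unital_star_hom_def, where ?'a = "('c, 'd) tpair malg"]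
  have ta: "to_completion (f + g) = to_completion f + to_completion g"
    and ts: "to_completion (k *\<^sub>C f) = k *\<^sub>C to_completion f"
    and tm: "to_completion (f * g) = to_completion f * to_completion g"
    and tst: "to_completion (star f) = star (to_completion f)"
    and t1: "to_completion (1 :: ('c, 'd) tpair malg) = 1"
    for f g :: "('c, 'd) tpair malg" and k
    using t by blast+
  have eq: "to_completion f = to_completion g" if "f - g \<in> rels" for f g :: "('c, 'd) tpair malg"
    using to_completion_rel[OF that] by (simp add: to_completion_diff)
  show "(c + c') \<otimes>\<^sub>m d = c \<otimes>\<^sub>m d + c' \<otimes>\<^sub>m d" "c \<otimes>\<^sub>m (d + d') = c \<otimes>\<^sub>m d + c \<otimes>\<^sub>m d'"
    unfolding tensor_def ta[symmetric] by (rule eq, rule tpair_rels)+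
  show "(k *\<^sub>C c) \<otimes>\<^sub>m d = k *\<^sub>C (c \<otimes>\<^sub>m d)" "c \<otimes>\<^sub>m (k *\<^sub>C d) = k *\<^sub>C (c \<otimes>\<^sub>m d)"
    unfolding tensor_def ts[symmetric] by (rule eq, rule tpair_rels)+
  show "(c \<otimes>\<^sub>m d) * (c' \<otimes>\<^sub>m d') = (c * c') \<otimes>\<^sub>m (d * d')"
    unfolding tensor_def tm[symmetric] by (simp add: times_malg_single times_tpair_def)
  show "star (c \<otimes>\<^sub>m d) = star c \<otimes>\<^sub>m star d"
    unfolding tensor_def tst[symmetric] by (simp add: star_malg_single star_tpair_def)
  show "(1 :: 'c) \<otimes>\<^sub>m (1 :: 'd) = 1"
    unfolding tensor_def t1[symmetric] by (simp add: one_malg_def one_tpair_def)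
qed


section \<open>The algebras generated by PVMs\<close>

typedef 'a linf = "UNIV :: ('a \<Rightarrow> complex) set"
  morphisms ev Linf ..

setup_lifting type_definition_linf

instantiation linf :: (finite) star_algebra
begin

lift_definition zero_linf :: "'a linf" is "\<lambda>_. 0" .
lift_definition one_linf :: "'a linf" is "\<lambda>_. 1" .
lift_definition plus_linf :: "'a linf \<Rightarrow> 'a linf \<Rightarrow> 'a linf" is "\<lambda>g h a. g a + h a" .
lift_definition minus_linf :: "'a linf \<Rightarrow> 'a linf \<Rightarrow> 'a linf" is "\<lambda>g h a. g a - h a" .
lift_definition uminus_linf :: "'a linf \<Rightarrow> 'a linf" is "\<lambda>g a. - g a" .
lift_definition times_linf :: "'a linf \<Rightarrow> 'a linf \<Rightarrow> 'a linf" is "\<lambda>g h a. g a * h a" .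
lift_definition scaleC_linf :: "complex \<Rightarrow> 'a linf \<Rightarrow> 'a linf" is "\<lambda>c g a. c * g a" .
lift_definition star_linf :: "'a linf \<Rightarrow> 'a linf" is "\<lambda>g a. cnj (g a)" .
definition scaleR_linf :: "real \<Rightarrow> 'a linf \<Rightarrow> 'a linf"
  where "scaleR_linf r = scaleC (complex_of_real r)"

instance
  by standard (simp add: scaleR_linf_def | transfer, force simp: algebra_simps)+

end

lemma ev_simps [simp]:
  "ev 0 a = 0" "ev 1 a = 1" "ev (g + h) a = ev g a + ev h a" "ev (g - h) a = ev g a - ev h a"
  "ev (- g) a = - ev g a" "ev (g * h) a = ev g a * ev h a" "ev (c *\<^sub>C g) a = c * ev g a"
  "ev (star g) a = cnj (ev g a)"
  by (transfer; simp)+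

lemma linf_eqI: "(\<And>a. ev g a = ev h a) \<Longrightarrow> g = h"
  by transfer (rule ext)

instantiation linf :: (finite) real_normed_algebra
begin

definition norm_linf :: "'a linf \<Rightarrow> real"
  where "norm_linf g = Max (range (\<lambda>a. cmod (ev g a)))"
definition dist_linf :: "'a linf \<Rightarrow> 'a linf \<Rightarrow> real"
  where "dist_linf x y = norm (x - y)"
definition sgn_linf :: "'a linf \<Rightarrow> 'a linf"
  where "sgn_linf x = x /\<^sub>R norm x"
definition uniformity_linf :: "('a linf \<times> 'a linf) filter"
  where "uniformity_linf = (INF e\<in>{0<..}. principal {(x, y). dist x y < e})"
definition open_linf :: "'a linf set \<Rightarrow> bool"
  where "open_linf U \<longleftrightarrow> (\<forall>x\<in>U. eventually (\<lambda>(x', y). x' = x \<longrightarrow> y \<in> U) uniformity)"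

lemma norm_ev_le: "cmod (ev g a) \<le> norm g" for g :: "'a linf"
  by (simp add: norm_linf_def)

lemma norm_linf_attained: "\<exists>a. norm g = cmod (ev g a)" for g :: "'a linf"
proof -
  have "Max (range (\<lambda>a. cmod (ev g a))) \<in> range (\<lambda>a. cmod (ev g a))" by (rule Max_in) auto
  then show ?thesis unfolding norm_linf_def by blast
qed

instance
proof
  fix x y :: "'a linf"
  show "dist x y = norm (x - y)" by (simp add: dist_linf_def)
  show "sgn x = x /\<^sub>R norm x" by (simp add: sgn_linf_def)
  show "uniformity = (INF e\<in>{0<..}. principal {(x, y::'a linf). dist x y < e})"
    by (simp add: uniformity_linf_def)
  show "open U \<longleftrightarrow> (\<forall>x\<in>U. eventually (\<lambda>(x', y). x' = x \<longrightarrow> y \<in> U) uniformity)" for U :: "'a linf set"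
    by (rule open_linf_def)
  show "norm x = 0 \<longleftrightarrow> x = 0"
  proof
    assume "norm x = 0"
    then show "x = 0" using norm_ev_le[of x] by (intro linf_eqI) simp
  next
    assume "x = 0" then show "norm x = 0" by (simp add: norm_linf_def)
  qed
  obtain a where "norm (x + y) = cmod (ev (x + y) a)" using norm_linf_attained by blast
  then show "norm (x + y) \<le> norm x + norm y"
    using norm_triangle_ineq[of "ev x a" "ev y a"] norm_ev_le[of x a] norm_ev_le[of y a] by simp
  obtain b where "norm (x * y) = cmod (ev (x * y) b)" using norm_linf_attained by blast
  then show "norm (x * y) \<le> norm x * norm y"
    using mult_mono[OF norm_ev_le[of x b] norm_ev_le[of y b]] norm_ev_le[of x b]
    by (simp add: norm_mult order_trans[OF norm_ge_zero])
  fix r :: real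
  obtain c where c: "norm (r *\<^sub>R x) = cmod (ev (r *\<^sub>R x) c)" using norm_linf_attained by blast
  obtain d where d: "norm x = cmod (ev x d)" using norm_linf_attained by blast
  show "norm (r *\<^sub>R x) = \<bar>r\<bar> * norm x"
  proof (rule antisym)
    show "norm (r *\<^sub>R x) \<le> \<bar>r\<bar> * norm x"
      unfolding c using norm_ev_le[of x c] by (simp add: scaleR_scaleC norm_mult mult_left_mono)
    show "\<bar>r\<bar> * norm x \<le> norm (r *\<^sub>R x)"
      unfolding d using norm_ev_le[of "r *\<^sub>R x" d] by (simp add: scaleR_scaleC norm_mult)
  qed
qed

end

instance linf :: (finite) cstar_algebra
proof
  fix x :: "'a linf" and k :: complex
  obtain c where c: "norm (k *\<^sub>C x) = cmod (ev (k *\<^sub>C x) c)" using norm_linf_attained by blast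
  obtain d where d: "norm x = cmod (ev x d)" using norm_linf_attained by blast
  show "norm (k *\<^sub>C x) = cmod k * norm x"
  proof (rule antisym)
    show "norm (k *\<^sub>C x) \<le> cmod k * norm x"
      unfolding c using norm_ev_le[of x c] by (simp add: norm_mult mult_left_mono)
    show "cmod k * norm x \<le> norm (k *\<^sub>C x)"
      unfolding d using norm_ev_le[of "k *\<^sub>C x" d] by (simp add: norm_mult)
  qed
  obtain b where b: "norm (star x * x) = cmod (ev (star x * x) b)" using norm_linf_attained by blast
  show "norm (star x * x) = (norm x)\<^sup>2"
  proof (rule antisym)
    show "norm (star x * x) \<le> (norm x)\<^sup>2"
      unfolding b using norm_ev_le[of x b] by (simp add: norm_mult power2_eq_square mult_mono)
    show "(norm x)\<^sup>2 \<le> norm (star x * x)"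
      unfolding d using norm_ev_le[of "star x * x" d] by (simp add: norm_mult power2_eq_square)
  qed
  fix X :: "nat \<Rightarrow> 'a linf" assume X: "Cauchy X"
  have "Cauchy (\<lambda>n. ev (X n) a)" for a
  proof (rule metric_CauchyI)
    fix e :: real assume "e > 0"
    then obtain N where N: "\<And>m n. m \<ge> N \<Longrightarrow> n \<ge> N \<Longrightarrow> dist (X m) (X n) < e"
      using metric_CauchyD[OF X] by blast
    have "dist (ev (X m) a) (ev (X n) a) \<le> dist (X m) (X n)" for m n
      using norm_ev_le[of "X m - X n" a] by (simp add: dist_norm)
    with N show "\<exists>N. \<forall>m\<ge>N. \<forall>n\<ge>N. dist (ev (X m) a) (ev (X n) a) < e"
      by (meson le_less_trans)
  qed
  then have "\<forall>a. \<exists>l. (\<lambda>n. ev (X n) a) \<longlonglongrightarrow> l"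
    using Cauchy_convergent convergent_def by blast
  then obtain l where l: "\<And>a. (\<lambda>n. ev (X n) a) \<longlonglongrightarrow> l a" by metis
  have ev_l: "ev (Linf l) = l" by (simp add: Linf_inverse)
  have "(\<lambda>n. norm (X n - Linf l)) \<longlonglongrightarrow> 0"
  proof (rule tendsto_sandwich[OF _ _ tendsto_const])
    have "(\<lambda>n. \<Sum>a\<in>UNIV. cmod (ev (X n) a - l a)) \<longlonglongrightarrow> (\<Sum>a\<in>(UNIV :: 'a set). 0)"
      by (intro tendsto_sum tendsto_norm_zero LIM_zero l)
    then show "(\<lambda>n. \<Sum>a\<in>UNIV. cmod (ev (X n) a - l a)) \<longlonglongrightarrow> 0" by simp
    have "norm (X n - Linf l) \<le> (\<Sum>a\<in>UNIV. cmod (ev (X n) a - l a))" for n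
    proof -
      obtain a where "norm (X n - Linf l) = cmod (ev (X n - Linf l) a)"
        using norm_linf_attained by blast
      also have "\<dots> = cmod (ev (X n) a - l a)" by (simp add: ev_l)
      also have "\<dots> \<le> (\<Sum>a\<in>UNIV. cmod (ev (X n) a - l a))"
        by (rule member_le_sum) simp_all
      finally show ?thesis .
    qed
    then show "\<forall>\<^sub>F n in sequentially. norm (X n - Linf l) \<le> (\<Sum>a\<in>UNIV. cmod (ev (X n) a - l a))"
      by (simp add: always_eventually)
  qed (simp add: always_eventually)
  then have "X \<longlonglongrightarrow> Linf l"
    by (simp add: tendsto_norm_zero_iff LIM_zero_iff)
  then show "convergent X" by (auto simp: convergent_def)
qed

type_synonym ('x, 'a) pvm_algebra = "('x, 'a linf) free_product"

text \<open>\<open>gen x a\<close> is $e_{x,a}$ (or $f_{y,b}$): the canonical basis vector \<open>a\<close> in the copy \<open>x\<close>.\<close>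

definition gen :: "'x \<Rightarrow> 'a::finite \<Rightarrow> ('x, 'a) pvm_algebra" where
  "gen x a = free_in x (Linf (\<lambda>k. if k = a then 1 else 0))"


section \<open>Quantum commuting correlations\<close>

class chilbert_space = complex_vector + banach +
  fixes cinner :: "'a \<Rightarrow> 'a \<Rightarrow> complex"
  assumes cinner_commute: "cinner x y = cnj (cinner y x)"
    and cinner_add_right: "cinner x (y + z) = cinner x y + cinner x z"
    and cinner_scaleC_right: "cinner x (c *\<^sub>C y) = c * cinner x y"
    and cinner_self: "cinner x x = complex_of_real ((norm x)\<^sup>2)"

definition is_projection :: "('h::chilbert_space \<Rightarrow> 'h) \<Rightarrow> bool" where
  "is_projection P \<longleftrightarrow>
     bounded_linear P \<and> (\<forall>c v. P (c *\<^sub>C v) = c *\<^sub>C P v) \<and>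
     (\<forall>v. P (P v) = P v) \<and> (\<forall>v w. cinner (P v) w = cinner v (P w))"

definition is_pvm :: "('a::finite \<Rightarrow> 'h::chilbert_space \<Rightarrow> 'h) \<Rightarrow> bool" where
  "is_pvm P \<longleftrightarrow> (\<forall>a. is_projection (P a)) \<and> (\<forall>v. (\<Sum>a\<in>UNIV. P a v) = v)"

text \<open>\<open>p a b x y\<close> stands for $p(a,b|x,y)$. HOL cannot quantify over types inside a formula, so the
  Hilbert space is a parameter; a hypothesis \<open>p \<in> qc_correlations TYPE('h)\<close> with a type
  variable \<open>'h\<close> covers all Hilbert spaces.\<close>

definition qc_correlations ::
  "'h::chilbert_space itself \<Rightarrow> ('a::finite \<Rightarrow> 'b::finite \<Rightarrow> 'x \<Rightarrow> 'y \<Rightarrow> real) set" where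
  "qc_correlations _ =
     {p. \<exists>(\<zeta> :: 'h) P Q.
        norm \<zeta> = 1 \<and> (\<forall>x. is_pvm (P x)) \<and> (\<forall>y. is_pvm (Q y)) \<and>
        (\<forall>x y a b. P x a \<circ> Q y b = Q y b \<circ> P x a) \<and>
        (\<forall>x y a b. complex_of_real (p a b x y) = cinner \<zeta> (P x a (Q y b \<zeta>)))}"


section \<open>Non-signalling games\<close>

definition is_game :: "('x::finite \<Rightarrow> 'y::finite \<Rightarrow> 'a::finite \<Rightarrow> 'b::finite \<Rightarrow> nat) \<Rightarrow> bool" where
  "is_game lam \<longleftrightarrow> (\<forall>x y a b. lam x y a b \<in> {0, 1})"

definition mirror_game :: "('x::finite \<Rightarrow> 'y::finite \<Rightarrow> 'a::finite \<Rightarrow> 'b::finite \<Rightarrow> nat) \<Rightarrow> bool" where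
  "mirror_game lam \<longleftrightarrow> is_game lam \<and>
     (\<exists>(\<xi> :: 'x \<Rightarrow> 'y) (\<eta> :: 'y \<Rightarrow> 'x).
        (\<forall>x b a a'. a \<noteq> a' \<longrightarrow> lam x (\<xi> x) a b * lam x (\<xi> x) a' b = 0) \<and>
        (\<forall>y a b b'. b \<noteq> b' \<longrightarrow> lam (\<eta> y) y a b * lam (\<eta> y) y a b' = 0))"

definition qc_strategies ::
  "'h::chilbert_space itself \<Rightarrow> ('x::finite \<Rightarrow> 'y::finite \<Rightarrow> 'a::finite \<Rightarrow> 'b::finite \<Rightarrow> nat) \<Rightarrow>
    ('a \<Rightarrow> 'b \<Rightarrow> 'x \<Rightarrow> 'y \<Rightarrow> real) set" where
  "qc_strategies H lam =
     {p \<in> qc_correlations H. \<forall>x y a b. lam x y a b = 0 \<longrightarrow> p a b x y = 0}"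

end

theory Submission
  imports Defs
begin

text \<open>
  The idea is that in a perfect strategy for a mirror game each player's measurement is determined,
  modulo the null ideal of the state, by one of the other player's.

  Fix a question \<open>y\<close> and put \<open>x = \<eta> y\<close>. For each answer \<open>a\<close> the rules allow at most one \<open>b\<close>;
  call it \<open>g y a\<close>, and let \<open>g y a\<close> be arbitrary if there is none. Then $s(e_{x,a} \otimes f_{y,b}) = 0$ whenever \<open>b \<noteq> g y a\<close>, and since
  $e_{x,a} \otimes f_{y,b}$ is a projection, it lies in the left ideal of all \<open>n\<close> with
  \<open>s (star n * n) = 0\<close>. By the Cauchy-Schwarz inequality, \<open>s\<close> vanishes on all products with
  this projection. Expanding \<open>1\<close> once by each of the two PVMs therefore shows that
  $1 \otimes f_{y,b}$ may be replaced by $\sum_{g(y,a) = b} e_{x,a} \otimes 1$ at either end of the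
  argument of \<open>s\<close>. This is \<open>positive_functional_correlated\<close>, and it holds in the same way
  with the two players exchanged, using \<open>\<xi>\<close>.

  For (i), replace $e_{x,a} \otimes 1$ by an element $1 \otimes q$, which commutes with every
  $z \otimes 1$, and replace it back at the other end:
  $\tau(z e_{x,a}) = s(z \otimes q) = \tau(e_{x,a} z)$. The elements that \<open>\<tau>\<close> commutes with in this
  sense form a closed subalgebra, so containing the generators it is everything
  (\<open>trace_if_gen_central\<close>).

  For (ii), the sums $\sum_{g(y,a) = b} e_{\eta(y),a}$ form a PVM for each \<open>y\<close>, so by the
  universal property of the free product they are the images $\rho(f_{y,b})$ under a unital *-homomorphism
  (\<open>coarse_graining_hom\<close>). In $s(z \otimes f_{y_1,b_1} \cdots f_{y_k,b_k})$ the last factor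
  may be replaced by $\rho(f_{y_k,b_k}) \otimes 1$, which then commutes past the remaining ones and
  joins \<open>z\<close>; repeating this moves the word to the left in reverse order.
\<close>

section \<open>Positive functionals\<close>

lemma linear_functional_simps:
  assumes "linear_functional f"
  shows "f (x + y) = f x + f y" "f (c *\<^sub>C x) = c * f x" "f 0 = 0" "f (x - y) = f x - f y"
    "f (sum g I) = (\<Sum>i\<in>I. f (g i))"
proof -
  have add: "f (x + y) = f x + f y" and scale: "f (c *\<^sub>C x) = c * f x" for x y c
    using assms by (auto simp: linear_functional_def)
  show "f (x + y) = f x + f y" "f (c *\<^sub>C x) = c * f x" by (fact add scale)+
  show zero: "f 0 = 0" using scale[of 0 0] by simp
  show "f (x - y) = f x - f y"
    using add[of x "- y"] scale[of "-1" y] by (simp add: scaleC_minus_one)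
  show "f (sum g I) = (\<Sum>i\<in>I. f (g i))"
    by (induction I rule: infinite_finite_induct) (simp_all add: add zero)
qed

context
  fixes s :: "'a::cstar_algebra \<Rightarrow> complex"
  assumes s: "positive_functional s"
begin

lemma positive_functional_linear: "linear_functional s"
  using s by (simp add: positive_functional_def)

lemmas pos_simps = linear_functional_simps[OF positive_functional_linear]

lemma positive_functional_nonneg: "0 \<le> Re (s (star x * x))" "Im (s (star x * x)) = 0"
  using s by (auto simp: positive_functional_def complex_nonneg_Reals_iff)

text \<open>Polarization: the diagonal values of the sesquilinear form are real, in particular at
  \<open>x + y\<close> and at \<open>x + \<i> y\<close>.\<close>

lemma positive_functional_hermitian: "s (star y * x) = cnj (s (star x * y))"
proof -
  have "Im (s (star (x + c *\<^sub>C y) * (x + c *\<^sub>C y))) = 0" for c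
    by (rule positive_functional_nonneg)
  then have *: "Im (s (star x * x) + c * s (star x * y) + cnj c * (s (star y * x) + c * s (star y * y))) = 0"
    for c
    by (simp add: distrib_left distrib_right pos_simps algebra_simps)
  show ?thesis
    using *[of 1] *[of \<i>] positive_functional_nonneg(2)[of x] positive_functional_nonneg(2)[of y]
    by (simp add: complex_eq_iff)
qed

lemma positive_functional_Cauchy_Schwarz:
  "(cmod (s (star x * y)))\<^sup>2 \<le> Re (s (star x * x)) * Re (s (star y * y))"
proof -
  define A where "A = Re (s (star x * x))"
  define B where "B = s (star x * y)"
  define D where "D = Re (s (star y * y))"
  have D: "s (star y * y) = of_real D" and A: "s (star x * x) = of_real A"
    using positive_functional_nonneg(2) by (simp_all add: A_def D_def complex_eq_iff)
  have nn: "0 \<le> A" "0 \<le> D" by (simp_all add: A_def D_def positive_functional_nonneg)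
  have BB: "(complex_of_real (cmod B))\<^sup>2 = B * cnj B"
    by (metis complex_norm_square of_real_power)
  \<comment> \<open>The value of the form at \<open>x + c y\<close>, with the phase of \<open>c\<close> chosen so that each cross term
    is \<open>- t * (cmod B)\<^sup>2\<close>.\<close>
  have quad: "0 \<le> A - 2 * t * (cmod B)\<^sup>2 + t\<^sup>2 * (cmod B)\<^sup>2 * D" for t
  proof -
    define c where "c = - of_real t * cnj B"
    have "s (star (x + c *\<^sub>C y) * (x + c *\<^sub>C y))
        = A + c * B + cnj c * cnj B + (c * cnj c) * D"
      using positive_functional_hermitian[of y x]
      by (simp add: distrib_left distrib_right pos_simps A D flip: B_def)
    also have "\<dots> = of_real (A - 2 * t * (cmod B)\<^sup>2 + t\<^sup>2 * (cmod B)\<^sup>2 * D)"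
      by (simp add: c_def BB power2_eq_square[of "complex_of_real t"] algebra_simps)
    finally show ?thesis
      using positive_functional_nonneg(1)[of "x + c *\<^sub>C y"] by simp
  qed
  have "(cmod B)\<^sup>2 \<le> A * D"
  proof (cases "D = 0")
    case True
    have "B = 0"
    proof (rule ccontr)
      assume "B \<noteq> 0"
      then show False
        using quad[of "(A + 1) / (2 * (cmod B)\<^sup>2)"] True by simp
    qed
    then show ?thesis using nn by simp
  next
    case False
    then show ?thesis using quad[of "1 / D"] nn by (simp add: field_simps power2_eq_square)
  qed
  then show ?thesis by (simp add: A_def B_def D_def)
qed

lemma positive_functional_null:
  assumes "s (star n * n) = 0"
  shows "s (v * n) = 0"
  using positive_functional_Cauchy_Schwarz[of "star v" n] assms by simp

text \<open>If \<open>h\<close> is self-adjoint and \<open>norm h < r\<close>, then \<open>1 - h / r\<close> has a self-adjoint square root, so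
  \<open>s\<close> is nonnegative there; Cauchy-Schwarz against \<open>1\<close> reduces the general case to
  \<open>star x * x\<close>.\<close>

lemma positive_functional_le_norm: "cmod (s x) \<le> Re (s 1) * norm x"
proof -
  have one: "0 \<le> Re (s 1)" using positive_functional_nonneg(1)[of 1] by simp
  have sa: "Re (s h) \<le> Re (s 1) * norm h" if h: "star h = h" for h
  proof -
    have "Re (s h) \<le> Re (s 1) * r" if r: "norm h < r" for r
    proof -
      have r0: "r > 0" using r norm_ge_zero[of h] by linarith
      obtain k where k: "star k = k" "k * k = 1 - (1 / r) *\<^sub>R h"
      proof (rule cstar_sqrt)
        show "norm ((1 / r) *\<^sub>R h) < 1" using r r0 by simp
        show "star ((1 / r) *\<^sub>R h) = (1 / r) *\<^sub>R h" by (simp add: h)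
      qed blast
      have "0 \<le> Re (s (1 - (1 / r) *\<^sub>R h))"
        using positive_functional_nonneg(1)[of k] k by simp
      also have "\<dots> = Re (s 1) - Re (s h) / r"
        by (simp add: pos_simps scaleR_scaleC)
      finally show ?thesis using r0 by (simp add: field_simps)
    qed
    then have "\<forall>\<^sub>F r in at_right (norm h). Re (s h) \<le> Re (s 1) * r"
      by (auto simp: eventually_at_right_field intro!: exI[of _ "norm h + 1"])
    moreover have "((\<lambda>r. Re (s 1) * r) \<longlongrightarrow> Re (s 1) * norm h) (at_right (norm h))"
      by (intro tendsto_intros)
    ultimately show ?thesis
      by (intro tendsto_lowerbound[OF _ _ trivial_limit_at_right_real])
  qed
  have "(cmod (s x))\<^sup>2 \<le> Re (s 1) * Re (s (star x * x))"
    using positive_functional_Cauchy_Schwarz[of 1 x] by simp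
  also have "\<dots> \<le> Re (s 1) * (Re (s 1) * (norm x)\<^sup>2)"
    using sa[of "star x * x"] one by (simp add: cstar_identity mult_left_mono)
  also have "\<dots> = (Re (s 1) * norm x)\<^sup>2" by (simp add: power2_eq_square)
  finally show ?thesis
    by (rule power2_le_imp_le) (simp add: one)
qed

lemma positive_functional_bounded_linear: "bounded_linear s"
  by (rule bounded_linear_intro[where K = "Re (s 1)"])
     (simp_all add: pos_simps scaleR_scaleC scaleR_conv_of_real mult.commute[of "norm _"]
       positive_functional_le_norm)

end

section \<open>The universal property of the free product\<close>

lemma unital_star_hom_simps:
  assumes "unital_star_hom \<phi>"
  shows "\<phi> (x + y) = \<phi> x + \<phi> y" "\<phi> (c *\<^sub>C x) = c *\<^sub>C \<phi> x" "\<phi> (x * y) = \<phi> x * \<phi> y"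
    "\<phi> (star x) = star (\<phi> x)" "\<phi> 1 = 1" "\<phi> 0 = 0" "\<phi> (x - y) = \<phi> x - \<phi> y"
    "\<phi> (sum g I) = (\<Sum>i\<in>I. \<phi> (g i))"
proof -
  have h: "\<phi> (x + y) = \<phi> x + \<phi> y" "\<phi> (c *\<^sub>C x) = c *\<^sub>C \<phi> x" "\<phi> (x * y) = \<phi> x * \<phi> y"
    "\<phi> (star x) = star (\<phi> x)" "\<phi> 1 = 1" for x y c
    using assms by (auto simp: unital_star_hom_def)
  show "\<phi> (x + y) = \<phi> x + \<phi> y" "\<phi> (c *\<^sub>C x) = c *\<^sub>C \<phi> x" "\<phi> (x * y) = \<phi> x * \<phi> y"
    "\<phi> (star x) = star (\<phi> x)" "\<phi> 1 = 1" by (fact h)+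
  show zero: "\<phi> 0 = 0" using h(2)[of 0 0] by simp
  show "\<phi> (x - y) = \<phi> x - \<phi> y"
    using h(1)[of x "- y"] h(2)[of "-1" y] by (simp add: scaleC_minus_one)
  show "\<phi> (sum g I) = (\<Sum>i\<in>I. \<phi> (g i))"
    by (induction I rule: infinite_finite_induct) (simp_all add: h zero)
qed

lemma tendsto_scaleC: "X \<longlonglongrightarrow> (x :: 'a::cstar_algebra) \<Longrightarrow> (\<lambda>n. c *\<^sub>C X n) \<longlonglongrightarrow> c *\<^sub>C x"
proof -
  have "bounded_linear (\<lambda>x :: 'a. c *\<^sub>C x)"
    by (rule bounded_linear_intro[where K = "cmod c"])
       (simp_all add: scaleC_add_right scaleR_scaleC norm_scaleC mult.commute)
  then show "X \<longlonglongrightarrow> x \<Longrightarrow> (\<lambda>n. c *\<^sub>C X n) \<longlonglongrightarrow> c *\<^sub>C x"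
    by (rule bounded_linear.tendsto)
qed

lemma completion_limit_obtain:
  obtains X where "(\<lambda>n. to_completion (X n)) \<longlonglongrightarrow> z"
proof -
  have "z \<in> closure (range to_completion)" by (simp add: to_completion_dense)
  then obtain Y where Y: "\<And>n. Y n \<in> range to_completion" "Y \<longlonglongrightarrow> z"
    unfolding closure_sequential by blast
  then have "\<forall>n. \<exists>x. Y n = to_completion x" by auto
  then obtain X where "\<And>n. Y n = to_completion (X n)" by metis
  with Y that[of X] show ?thesis by (metis (no_types, lifting) ext)
qed

text \<open>A contraction maps Cauchy sequences to Cauchy sequences, so \<open>\<Phi> z\<close> can be taken as the limit
  of \<open>\<phi>\<close> along any sequence tending to \<open>z\<close>; independence of the sequence makes \<open>\<Phi>\<close> inherit
  every algebraic identity.\<close>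

lemma extend_to_completion:
  fixes \<phi> :: "'a::cstar_seminormed \<Rightarrow> 'b::cstar_algebra"
  assumes hom: "unital_star_hom \<phi>" and bd: "\<And>f. norm (\<phi> f) \<le> usn f"
  obtains \<Phi> where "unital_star_hom \<Phi>" "\<And>f. \<Phi> (to_completion f) = \<phi> f"
proof -
  note h = unital_star_hom_simps[OF hom]
  note t = unital_star_hom_simps[OF unital_star_hom_to_completion, symmetric]
  have "\<forall>z. \<exists>X. (\<lambda>n. to_completion (X n :: 'a)) \<longlonglongrightarrow> z"
    using completion_limit_obtain by metis
  then obtain R where R: "\<And>z. (\<lambda>n. to_completion (R z n :: 'a)) \<longlonglongrightarrow> z" by metis
  have contr: "dist (\<phi> f) (\<phi> g) \<le> dist (to_completion f) (to_completion g)" for f g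
    using bd[of "f - g"] by (simp add: dist_norm h norm_to_completion flip: to_completion_diff)
  define \<Phi> where "\<Phi> z = lim (\<lambda>n. \<phi> (R z n))" for z
  have "convergent (\<lambda>n. \<phi> (R z n))" for z
  proof (rule Cauchy_convergent, rule metric_CauchyI)
    fix e :: real assume "e > 0"
    then show "\<exists>M. \<forall>m\<ge>M. \<forall>n\<ge>M. dist (\<phi> (R z m)) (\<phi> (R z n)) < e"
      using metric_CauchyD[OF LIMSEQ_imp_Cauchy[OF R[of z]]] contr by (meson le_less_trans)
  qed
  then have \<Phi>R: "(\<lambda>n. \<phi> (R z n)) \<longlonglongrightarrow> \<Phi> z" for z
    unfolding \<Phi>_def by (rule convergent_LIMSEQ_iff[THEN iffD1])
  have \<Phi>: "(\<lambda>n. \<phi> (X n)) \<longlonglongrightarrow> \<Phi> z" if X: "(\<lambda>n. to_completion (X n)) \<longlonglongrightarrow> z" for X z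
  proof -
    have "(\<lambda>n. dist (to_completion (R z n)) (to_completion (X n))) \<longlonglongrightarrow> 0"
      using tendsto_dist[OF R[of z] X] by simp
    then have "(\<lambda>n. \<phi> (X n) - \<phi> (R z n)) \<longlonglongrightarrow> 0"
      by (rule Lim_null_comparison[rotated]) (use contr in \<open>simp add: dist_norm norm_minus_commute\<close>)
    with \<Phi>R[of z] show ?thesis by (rule Lim_transform)
  qed
  have ext: "\<Phi> (to_completion f) = \<phi> f" for f
    using \<Phi>[OF tendsto_const] by (rule LIMSEQ_unique) (rule tendsto_const)
  have "unital_star_hom \<Phi>"
    unfolding unital_star_hom_def
  proof (intro conjI allI)
    fix z w :: "'a completion" and c
    have "(\<lambda>n. \<phi> (R z n + R w n)) \<longlonglongrightarrow> \<Phi> (z + w)"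
      by (rule \<Phi>) (use tendsto_add[OF R[of z] R[of w]] in \<open>simp add: t\<close>)
    moreover have "(\<lambda>n. \<phi> (R z n + R w n)) \<longlonglongrightarrow> \<Phi> z + \<Phi> w"
      unfolding h by (rule tendsto_add[OF \<Phi>R \<Phi>R])
    ultimately show "\<Phi> (z + w) = \<Phi> z + \<Phi> w" by (rule LIMSEQ_unique)
    have "(\<lambda>n. \<phi> (R z n * R w n)) \<longlonglongrightarrow> \<Phi> (z * w)"
      by (rule \<Phi>) (use tendsto_mult[OF R[of z] R[of w]] in \<open>simp add: t\<close>)
    moreover have "(\<lambda>n. \<phi> (R z n * R w n)) \<longlonglongrightarrow> \<Phi> z * \<Phi> w"
      unfolding h by (rule tendsto_mult[OF \<Phi>R \<Phi>R])
    ultimately show "\<Phi> (z * w) = \<Phi> z * \<Phi> w" by (rule LIMSEQ_unique)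
    have "(\<lambda>n. \<phi> (c *\<^sub>C R z n)) \<longlonglongrightarrow> \<Phi> (c *\<^sub>C z)"
      by (rule \<Phi>) (use tendsto_scaleC[OF R[of z]] in \<open>simp add: t\<close>)
    moreover have "(\<lambda>n. \<phi> (c *\<^sub>C R z n)) \<longlonglongrightarrow> c *\<^sub>C \<Phi> z"
      unfolding h by (rule tendsto_scaleC[OF \<Phi>R])
    ultimately show "\<Phi> (c *\<^sub>C z) = c *\<^sub>C \<Phi> z" by (rule LIMSEQ_unique)
    have "(\<lambda>n. \<phi> (star (R z n))) \<longlonglongrightarrow> \<Phi> (star z)"
      by (rule \<Phi>) (use bounded_linear.tendsto[OF bounded_linear_star R[of z]] in \<open>simp add: t\<close>)
    moreover have "(\<lambda>n. \<phi> (star (R z n))) \<longlonglongrightarrow> star (\<Phi> z)"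
      unfolding h by (rule bounded_linear.tendsto[OF bounded_linear_star \<Phi>R])
    ultimately show "\<Phi> (star z) = star (\<Phi> z)" by (rule LIMSEQ_unique)
    show "\<Phi> 1 = 1" using ext[of 1] by (simp add: h flip: t)
  qed
  with ext that show ?thesis by blast
qed

lemma unital_star_hom_lin_ext:
  fixes F :: "'m::star_monoid \<Rightarrow> 'b::star_algebra"
  assumes "F 1 = 1" "\<And>u v. F (u * v) = F u * F v" "\<And>u. F (star u) = star (F u)"
  shows "unital_star_hom (lin_ext F)"
proof -
  have mult1: "lin_ext F (single u * g) = F u * lin_ext F g" for u g
    by (induction g rule: malg_induct)
       (simp_all add: distrib_left times_malg_single assms)
  have "lin_ext F (f * g) = lin_ext F f * lin_ext F g" for f g
    by (induction f rule: malg_induct) (simp_all add: distrib_right mult1)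
  moreover have "lin_ext F (star f) = star (lin_ext F f)" for f
    by (induction f rule: malg_induct) (simp_all add: star_malg_single assms)
  ultimately show ?thesis by (simp add: unital_star_hom_def one_malg_def assms)
qed

text \<open>The product of the \<open>\<pi>\<close>-images of the letters of a word defines a *-homomorphism on the monoid
  algebra. Pulling back the norm along it gives a C*-seminorm that vanishes on the relators, hence
  lies below the universal one, and so the homomorphism extends to the completion.\<close>

lemma free_product_universal:
  fixes \<pi> :: "'x \<Rightarrow> 'c::cstar_algebra \<Rightarrow> 'd::cstar_algebra"
  assumes hom: "\<And>x. unital_star_hom (\<pi> x)"
  obtains \<Phi> :: "('x, 'c) free_product \<Rightarrow> 'd"
  where "unital_star_hom \<Phi>" "\<And>x c. \<Phi> (free_in x c) = \<pi> x c"
proof -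
  note h = unital_star_hom_simps[OF hom]
  define F where "F w = (\<Prod>(x, c)\<leftarrow>letters w. \<pi> x c)" for w
  have star_prod: "star (prod_list l) = prod_list (rev (map star l))" for l :: "'d list"
    by (induction l) simp_all
  have \<phi>: "unital_star_hom (lin_ext F)"
  proof (rule unital_star_hom_lin_ext)
    show "F (star u) = star (F u)" for u
      by (simp add: F_def star_fword_def star_prod rev_map h comp_def split_def)
  qed (simp_all add: F_def one_fword_def times_fword_def)
  note \<phi>_simps = unital_star_hom_simps[OF \<phi>]
  have letter: "lin_ext F (letter x c) = \<pi> x c" for x c
    by (simp add: F_def)
  have "admissible (\<lambda>f. norm (lin_ext F f))"
    unfolding admissible_def
  proof
    show "cstar_seminorm (\<lambda>f. norm (lin_ext F f))"
      by (simp add: cstar_seminorm_def \<phi>_simps norm_triangle_ineq norm_scaleC norm_mult_ineq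
          cstar_identity del: lin_ext_add lin_ext_scaleC)
    show "\<forall>r\<in>rels. norm (lin_ext F r) = 0"
      unfolding rels_fword_def
      by (auto simp: \<phi>_simps letter h simp del: lin_ext_single)
  qed
  then have "norm (lin_ext F f) \<le> usn f" for f
    using admissible_le_usn[OF bounded_fword] by fast
  with \<phi> obtain \<Phi> where "unital_star_hom \<Phi>" "\<And>f. \<Phi> (to_completion f) = lin_ext F f"
    using extend_to_completion by blast
  then show ?thesis using that[of \<Phi>] by (simp add: free_in_def letter del: lin_ext_single)
qed

lemma free_product_induct [case_names closed one free_in add scaleC]:
  assumes closed: "closed {z. P z}"
    and one: "P 1"
    and free_in: "\<And>x c z. P z \<Longrightarrow> P (free_in x c * z)"
    and add: "\<And>z w. P z \<Longrightarrow> P w \<Longrightarrow> P (z + w)"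
    and scaleC: "\<And>k z. P z \<Longrightarrow> P (k *\<^sub>C z)"
  shows "P (z :: ('x, 'c::cstar_algebra) free_product)"
proof -
  note t = unital_star_hom_simps[OF unital_star_hom_to_completion]
  have word: "P (to_completion (single (FWord w)))" for w
  proof (induction w)
    case Nil
    show ?case using one by (metis t(5) one_malg_def one_fword_def)
  next
    case (Cons a w)
    obtain x c where a: "a = (x, c)" by fastforce
    have "single (FWord (a # w)) = letter x c * single (FWord w)"
      by (simp add: times_malg_single times_fword_def a)
    then show ?case using free_in[OF Cons] by (simp add: t free_in_def)
  qed
  have "P (to_completion f)" for f
  proof (induction f rule: malg_induct)
    case (single m)
    show ?case using word[of "letters m"] by simp
  qed (simp_all add: t add scaleC)
  then have "closure (range to_completion) \<subseteq> {z. P z}"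
    by (intro closure_minimal closed) auto
  then show ?thesis by (auto simp: to_completion_dense)
qed

section \<open>The generating PVMs\<close>

abbreviation delta :: "'a \<Rightarrow> 'a::finite linf" where
  "delta a \<equiv> Linf (\<lambda>k. if k = a then 1 else 0)"

lemma ev_Linf [simp]: "ev (Linf g) = g"
  by (simp add: Linf_inverse)

lemma ev_sum: "ev (sum g I) a = (\<Sum>i\<in>I. ev (g i) a)"
  by (induction I rule: infinite_finite_induct) simp_all

lemma linf_expand: "c = (\<Sum>a\<in>UNIV. ev c a *\<^sub>C delta a)"
  by (rule linf_eqI) (simp add: ev_sum if_distrib cong: if_cong)

lemma free_in_expand: "free_in x c = (\<Sum>a\<in>UNIV. ev c a *\<^sub>C gen x a)"
  by (subst linf_expand[of c])
     (simp add: unital_star_hom_simps[OF unital_star_hom_free_in] gen_def)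

lemma star_gen: "star (gen x a) = gen x a"
proof -
  have "star (delta a) = delta a" by (rule linf_eqI) simp
  then show ?thesis by (simp add: gen_def flip: unital_star_hom_simps(4)[OF unital_star_hom_free_in])
qed

lemma gen_idem: "gen x a * gen x a = gen x a"
proof -
  have "delta a * delta a = delta a" by (rule linf_eqI) simp
  then show ?thesis by (simp add: gen_def flip: unital_star_hom_simps(3)[OF unital_star_hom_free_in])
qed

lemma sum_gen: "(\<Sum>a\<in>UNIV. gen x a) = 1"
  using free_in_expand[of x 1] by (simp add: unital_star_hom_simps[OF unital_star_hom_free_in])

lemma unital_star_hom_pullback:
  "unital_star_hom (\<lambda>c. Linf (\<lambda>a. ev c (g a)) :: 'a::finite linf)"
  unfolding unital_star_hom_def by (auto intro!: linf_eqI)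

text \<open>Precomposition with \<open>g y\<close> is a unital *-homomorphism from functions on \<open>'b\<close> to functions on \<open>'a\<close>
  and maps the indicator of \<open>b\<close> to that of the fibre over \<open>b\<close>; follow it by the embedding of the
  copy \<open>\<eta> y\<close>. In terms of PVMs, outcomes \<open>a\<close> with the same \<open>g y a\<close> are merged.\<close>

lemma coarse_graining_hom:
  fixes g :: "'y \<Rightarrow> 'a::finite \<Rightarrow> 'b::finite" and \<eta> :: "'y \<Rightarrow> 'x"
  obtains \<rho> :: "('y, 'b) pvm_algebra \<Rightarrow> ('x, 'a) pvm_algebra"
  where "unital_star_hom \<rho>" "\<And>y b. \<rho> (gen y b) = (\<Sum>a | g y a = b. gen (\<eta> y) a)"
proof -
  define \<pi> where "\<pi> y c = (free_in (\<eta> y) (Linf (\<lambda>a. ev c (g y a))) :: ('x, 'a) pvm_algebra)" for y c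
  have "unital_star_hom (\<pi> y)" for y
    using unital_star_hom_pullback[of "g y"] unital_star_hom_free_in[of "\<eta> y", where 'c = "'a linf"]
    unfolding unital_star_hom_def \<pi>_def by simp
  then obtain \<rho> where \<rho>: "unital_star_hom \<rho>" "\<And>y c. \<rho> (free_in y c) = \<pi> y c"
    using free_product_universal by blast
  have "\<rho> (gen y b) = (\<Sum>a | g y a = b. gen (\<eta> y) a)" for y b
  proof -
    have "\<rho> (gen y b) = (\<Sum>a\<in>UNIV. (if g y a = b then 1 else 0) *\<^sub>C gen (\<eta> y) a)"
      unfolding gen_def[of y] \<rho>(2) \<pi>_def by (subst free_in_expand) simp
    also have "\<dots> = (\<Sum>a\<in>UNIV. if g y a = b then gen (\<eta> y) a else 0)"
      by (rule sum.cong) simp_all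
    also have "\<dots> = (\<Sum>a | g y a = b. gen (\<eta> y) a)"
      by (simp add: sum.If_cases)
    finally show ?thesis .
  qed
  with \<rho>(1) that show ?thesis by blast
qed

text \<open>The \<open>w\<close> with \<open>\<tau> (z * w) = \<tau> (w * z)\<close> for all \<open>z\<close> form a subalgebra, which is closed because
  positive functionals are continuous.\<close>

lemma trace_if_gen_central:
  fixes \<tau> :: "('x, 'a::finite) pvm_algebra \<Rightarrow> complex"
  assumes pos: "positive_functional \<tau>"
    and gen: "\<And>x a z. \<tau> (z * gen x a) = \<tau> (gen x a * z)"
  shows "is_trace \<tau>"
proof -
  note lin = linear_functional_simps[OF positive_functional_linear[OF pos]]
  note cont = bounded_linear.continuous_on[OF positive_functional_bounded_linear[OF pos]]
  have fi: "\<tau> (z * free_in x c) = \<tau> (free_in x c * z)" for x c z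
    by (simp add: free_in_expand sum_distrib_left sum_distrib_right lin gen)
  have "\<forall>z. \<tau> (z * w) = \<tau> (w * z)" for w
  proof (induction w rule: free_product_induct)
    case closed
    show ?case
      by (intro closed_Collect_all closed_Collect_eq cont continuous_intros)
  next
    case (free_in x c w)
    show ?case
    proof
      fix z
      have "\<tau> (z * (free_in x c * w)) = \<tau> ((z * free_in x c) * w)" by (simp add: mult.assoc)
      also have "\<dots> = \<tau> (w * (z * free_in x c))" using free_in by blast
      also have "\<dots> = \<tau> ((w * z) * free_in x c)" by (simp add: mult.assoc)
      also have "\<dots> = \<tau> (free_in x c * (w * z))" by (rule fi)
      also have "\<dots> = \<tau> (free_in x c * w * z)" by (simp add: mult.assoc)
      finally show "\<tau> (z * (free_in x c * w)) = \<tau> (free_in x c * w * z)" .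
    qed
  qed (simp_all add: lin distrib_left distrib_right)
  then show ?thesis using pos by (simp add: is_trace_def)
qed

section \<open>Perfectly correlated commuting PVMs\<close>

text \<open>Both sides equal the value of \<open>L\<close> at the sum of \<open>E a * F b\<close> over the fibre of \<open>g\<close> above \<open>b\<close>:
  insert the sum of the \<open>E a\<close> into the left one and the sum of the \<open>F b'\<close> into the right one.\<close>

lemma linear_functional_correlated:
  fixes E :: "'a::finite \<Rightarrow> 'c::star_algebra" and F :: "'b::finite \<Rightarrow> 'c"
  assumes L: "linear_functional L"
    and E: "(\<Sum>a\<in>UNIV. E a) = 1" and F: "(\<Sum>b\<in>UNIV. F b) = 1"
    and null: "\<And>a b. g a \<noteq> b \<Longrightarrow> L (E a * F b) = 0"
  shows "L (F b) = L (\<Sum>a | g a = b. E a)"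
proof -
  note lin = linear_functional_simps[OF L]
  have "L (F b) = L ((\<Sum>a\<in>UNIV. E a) * F b)" by (simp add: E)
  also have "\<dots> = (\<Sum>a\<in>UNIV. L (E a * F b))" by (simp add: sum_distrib_right lin)
  also have "\<dots> = (\<Sum>a | g a = b. L (E a * F b))"
    by (rule sum.mono_neutral_right) (auto simp: null)
  also have "\<dots> = (\<Sum>a | g a = b. \<Sum>b'\<in>UNIV. L (E a * F b'))"
  proof (rule sum.cong)
    fix a assume "a \<in> {a. g a = b}"
    then have "(\<Sum>b'\<in>UNIV. L (E a * F b')) = (\<Sum>b'\<in>{b}. L (E a * F b'))"
      by (intro sum.mono_neutral_right) (auto simp: null)
    then show "L (E a * F b) = (\<Sum>b'\<in>UNIV. L (E a * F b'))" by simp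
  qed simp
  also have "\<dots> = (\<Sum>a | g a = b. L (E a * (\<Sum>b'\<in>UNIV. F b')))"
    by (simp add: sum_distrib_left lin)
  also have "\<dots> = L (\<Sum>a | g a = b. E a)" by (simp add: F lin)
  finally show ?thesis .
qed

text \<open>For commuting PVMs each \<open>E a * F b\<close> is a projection, so \<open>s (E a * F b) = 0\<close> already says that
  it is null, and then \<open>s\<close> vanishes on all its left and right multiples.\<close>

lemma positive_functional_correlated:
  fixes s :: "'c::cstar_algebra \<Rightarrow> complex"
    and E :: "'a::finite \<Rightarrow> 'c" and F :: "'b::finite \<Rightarrow> 'c"
  assumes s: "positive_functional s"
    and E: "\<And>a. star (E a) = E a" "\<And>a. E a * E a = E a" "(\<Sum>a\<in>UNIV. E a) = 1"
    and F: "\<And>b. star (F b) = F b" "\<And>b. F b * F b = F b" "(\<Sum>b\<in>UNIV. F b) = 1"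
    and comm: "\<And>a b. E a * F b = F b * E a"
    and corr: "\<And>a b. g a \<noteq> b \<Longrightarrow> s (E a * F b) = 0"
  shows "s (v * F b) = s (v * (\<Sum>a | g a = b. E a))"
    and "s (F b * v) = s ((\<Sum>a | g a = b. E a) * v)"
proof -
  note lin = linear_functional_simps[OF positive_functional_linear[OF s]]
  have sa: "star (E a * F b) = E a * F b" for a b
    by (simp add: E F comm)
  have idem: "(E a * F b) * (E a * F b) = E a * F b" for a b
    by (metis E(2) F(2) comm mult.assoc)
  have right: "s (v * (E a * F b)) = 0" if "g a \<noteq> b" for a b v
    by (rule positive_functional_null[OF s]) (simp only: sa idem corr[OF that])
  have left: "s (E a * F b * v) = 0" if "g a \<noteq> b" for a b v
    using positive_functional_hermitian[OF s, of "E a * F b" v] right[OF that, of "star v"]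
    by (simp only: sa complex_cnj_zero)
  show "s (v * F b) = s (v * (\<Sum>a | g a = b. E a))"
    by (rule linear_functional_correlated[of "\<lambda>u. s (v * u)", OF _ E(3) F(3) right])
       (simp_all add: linear_functional_def distrib_left lin)
  show "s (F b * v) = s ((\<Sum>a | g a = b. E a) * v)"
    by (rule linear_functional_correlated[of "\<lambda>u. s (u * v)", OF _ E(3) F(3) left])
       (simp_all add: linear_functional_def distrib_right lin)
qed

lemma tensor_zero: "0 \<otimes>\<^sub>m d = 0" "c \<otimes>\<^sub>m 0 = 0"
  using tensor_scaleC_left[of 0 0 d] tensor_scaleC_right[of c 0 0] by simp_all

lemma tensor_sum:
  "(\<Sum>i\<in>I. c i) \<otimes>\<^sub>m d = (\<Sum>i\<in>I. c i \<otimes>\<^sub>m d)"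
  "c' \<otimes>\<^sub>m (\<Sum>i\<in>I. d' i) = (\<Sum>i\<in>I. c' \<otimes>\<^sub>m d' i)"
  by (induction I rule: infinite_finite_induct)
     (simp_all add: tensor_zero tensor_add_left tensor_add_right)

text \<open>The two instances for the PVMs of the two players: one measurement of the first player
  determines one of the second, or conversely.\<close>

lemma state_correlated:
  fixes s :: "(('x, 'a::finite) pvm_algebra, ('y, 'b::finite) pvm_algebra) max_tensor \<Rightarrow> complex"
  assumes s: "positive_functional s"
  shows "(\<And>a b. g a \<noteq> b \<Longrightarrow> s (gen x a \<otimes>\<^sub>m gen y b) = 0) \<Longrightarrow>
      s (v * (1 \<otimes>\<^sub>m gen y b)) = s (v * ((\<Sum>a | g a = b. gen x a) \<otimes>\<^sub>m 1))"
    and "(\<And>a b. h b \<noteq> a \<Longrightarrow> s (gen x a \<otimes>\<^sub>m gen y b) = 0) \<Longrightarrow>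
      s (v * (gen x a \<otimes>\<^sub>m 1)) = s (v * (1 \<otimes>\<^sub>m (\<Sum>b | h b = a. gen y b))) \<and>
      s ((gen x a \<otimes>\<^sub>m 1) * v) = s ((1 \<otimes>\<^sub>m (\<Sum>b | h b = a. gen y b)) * v)"
proof -
  let ?E = "\<lambda>a. gen x a \<otimes>\<^sub>m (1 :: ('y, 'b) pvm_algebra)"
  let ?F = "\<lambda>b. (1 :: ('x, 'a) pvm_algebra) \<otimes>\<^sub>m gen y b"
  have E: "star (?E a) = ?E a" "?E a * ?E a = ?E a" "(\<Sum>a\<in>UNIV. ?E a) = 1" for a
    by (simp_all add: tensor_star star_gen tensor_mult gen_idem sum_gen tensor_one
        flip: tensor_sum)
  have F: "star (?F b) = ?F b" "?F b * ?F b = ?F b" "(\<Sum>b\<in>UNIV. ?F b) = 1" for b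
    by (simp_all add: tensor_star star_gen tensor_mult gen_idem sum_gen tensor_one
        flip: tensor_sum)
  have EF: "?E a * ?F b = gen x a \<otimes>\<^sub>m gen y b" "?F b * ?E a = gen x a \<otimes>\<^sub>m gen y b" for a b
    by (simp_all add: tensor_mult)
  show "s (v * ?F b) = s (v * ((\<Sum>a | g a = b. gen x a) \<otimes>\<^sub>m 1))"
    if "\<And>a b. g a \<noteq> b \<Longrightarrow> s (gen x a \<otimes>\<^sub>m gen y b) = 0"
    unfolding tensor_sum
    by (rule positive_functional_correlated(1)[OF s E F, where g = g]) (simp_all add: EF that)
  show "s (v * ?E a) = s (v * (1 \<otimes>\<^sub>m (\<Sum>b | h b = a. gen y b))) \<and>
      s (?E a * v) = s ((1 \<otimes>\<^sub>m (\<Sum>b | h b = a. gen y b)) * v)"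
    if "\<And>a b. h b \<noteq> a \<Longrightarrow> s (gen x a \<otimes>\<^sub>m gen y b) = 0"
    unfolding tensor_sum
    by (intro conjI positive_functional_correlated[OF s F E, where g = h]) (simp_all add: EF that)
qed

theorem theorem6p1:
  fixes lam :: "'x::finite \<Rightarrow> 'y::finite \<Rightarrow> 'a::finite \<Rightarrow> 'b::finite \<Rightarrow> nat"
    and p :: "'a \<Rightarrow> 'b \<Rightarrow> 'x \<Rightarrow> 'y \<Rightarrow> real"
    and s :: "(('x, 'a) pvm_algebra, ('y, 'b) pvm_algebra) max_tensor \<Rightarrow> complex"
    and \<tau> :: "('x, 'a) pvm_algebra \<Rightarrow> complex"
  assumes "mirror_game lam"
    and "p \<in> qc_strategies TYPE('h::chilbert_space) lam"
    and "is_state s"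
    and "\<And>x y a b. complex_of_real (p a b x y) = s (gen x a \<otimes>\<^sub>m gen y b)"
    and "\<And>z. \<tau> z = s (z \<otimes>\<^sub>m 1)"
  shows "is_trace \<tau> \<and>
    (\<exists>\<rho> :: ('y, 'b) pvm_algebra \<Rightarrow> ('x, 'a) pvm_algebra.
       unital_star_hom \<rho> \<and>
       (\<forall>x y a b. complex_of_real (p a b x y) = \<tau> (gen x a * \<rho> (gen y b))) \<and>
       (\<forall>z (yb :: ('y \<times> 'b) list).
          s (z \<otimes>\<^sub>m (\<Prod>(y, b)\<leftarrow>yb. gen y b)) = \<tau> (z * \<rho> (\<Prod>(y, b)\<leftarrow>rev yb. gen y b))))"
proof -
  obtain \<xi> \<eta> where
    \<xi>: "\<And>x b a a'. a \<noteq> a' \<Longrightarrow> lam x (\<xi> x) a b * lam x (\<xi> x) a' b = 0" and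
    \<eta>: "\<And>y a b b'. b \<noteq> b' \<Longrightarrow> lam (\<eta> y) y a b * lam (\<eta> y) y a b' = 0"
    using assms(1) unfolding mirror_game_def by metis
  have pos: "positive_functional s" using assms(3) by (simp add: is_state_def)
  note lin = linear_functional_simps[OF positive_functional_linear[OF pos]]
  have zero: "s (gen x a \<otimes>\<^sub>m gen y b) = 0" if "lam x y a b = 0" for x y a b
    using assms(2) that by (simp add: qc_strategies_def flip: assms(4))
  \<comment> \<open>An answer that admits no winning reply gets an arbitrary one: there every value of \<open>lam\<close>
    is 0, so the implications below still hold.\<close>
  define g where "g y a = (SOME b. lam (\<eta> y) y a b \<noteq> 0)" for y a
  define h where "h x b = (SOME a. lam x (\<xi> x) a b \<noteq> 0)" for x b
  have "lam (\<eta> y) y a b = 0" if "g y a \<noteq> b" for y a b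
    using \<eta>[OF that, of y a] someI[of "\<lambda>b. lam (\<eta> y) y a b \<noteq> 0" b] by (metis g_def mult_is_0)
  then have g: "s (gen (\<eta> y) a \<otimes>\<^sub>m gen y b) = 0" if "g y a \<noteq> b" for y a b
    using zero that by blast
  have "lam x (\<xi> x) a b = 0" if "h x b \<noteq> a" for x a b
    using \<xi>[OF that, of x b] someI[of "\<lambda>a. lam x (\<xi> x) a b \<noteq> 0" a] by (metis h_def mult_is_0)
  then have h: "s (gen x a \<otimes>\<^sub>m gen (\<xi> x) b) = 0" if "h x b \<noteq> a" for x a b
    using zero that by blast

  have "positive_functional \<tau>"
    unfolding positive_functional_def linear_functional_def
  proof (intro conjI allI)
    show "\<tau> (star z * z) \<in> \<real>\<^sub>\<ge>\<^sub>0" for z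
      using positive_functional_nonneg[OF pos, of "z \<otimes>\<^sub>m 1"]
      by (simp add: assms(5) tensor_star tensor_mult complex_nonneg_Reals_iff)
  qed (simp_all add: assms(5) tensor_add_left tensor_scaleC_left lin)
  moreover have "\<tau> (z * gen x a) = \<tau> (gen x a * z)" for x a z
  proof -
    let ?q = "\<Sum>b | h x b = a. gen (\<xi> x) b"
    have "\<tau> (z * gen x a) = s ((z \<otimes>\<^sub>m 1) * (gen x a \<otimes>\<^sub>m 1))"
      by (simp add: assms(5) tensor_mult)
    also have "\<dots> = s ((z \<otimes>\<^sub>m 1) * (1 \<otimes>\<^sub>m ?q))"
      using state_correlated(2)[OF pos h] by blast
    also have "\<dots> = s ((1 \<otimes>\<^sub>m ?q) * (z \<otimes>\<^sub>m 1))"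
      by (simp add: tensor_mult)
    also have "\<dots> = s ((gen x a \<otimes>\<^sub>m 1) * (z \<otimes>\<^sub>m 1))"
      using state_correlated(2)[OF pos h] by metis
    also have "\<dots> = \<tau> (gen x a * z)"
      by (simp add: assms(5) tensor_mult)
    finally show ?thesis .
  qed
  ultimately have trace: "is_trace \<tau>" by (rule trace_if_gen_central)

  obtain \<rho> :: "('y, 'b) pvm_algebra \<Rightarrow> ('x, 'a) pvm_algebra"
    where \<rho>: "unital_star_hom \<rho>" "\<And>y b. \<rho> (gen y b) = (\<Sum>a | g y a = b. gen (\<eta> y) a)"
    using coarse_graining_hom[where g = g and \<eta> = \<eta>] by blast
  \<comment> \<open>The last letter of the word moves to the left tensor factor, to the right of \<open>z\<close>, so the induction
    removes letters from the end, for all \<open>z\<close> at once.\<close>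
  have words: "s (z \<otimes>\<^sub>m (\<Prod>(y, b)\<leftarrow>yb. gen y b)) = \<tau> (z * \<rho> (\<Prod>(y, b)\<leftarrow>rev yb. gen y b))"
    for z and yb :: "('y \<times> 'b) list"
  proof (induction yb arbitrary: z rule: rev_induct)
    case Nil
    show ?case by (simp add: assms(5) unital_star_hom_simps[OF \<rho>(1)])
  next
    case (snoc q yb)
    obtain y b where q: "q = (y, b)" by fastforce
    let ?w = "\<Prod>(y, b)\<leftarrow>yb. gen y b"
    have "s (z \<otimes>\<^sub>m (\<Prod>(y, b)\<leftarrow>yb @ [q]. gen y b)) = s ((z \<otimes>\<^sub>m ?w) * (1 \<otimes>\<^sub>m gen y b))"
      by (simp add: q tensor_mult)
    also have "\<dots> = s ((z \<otimes>\<^sub>m ?w) * (\<rho> (gen y b) \<otimes>\<^sub>m 1))"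
      unfolding \<rho>(2) by (rule state_correlated(1)[OF pos g])
    also have "\<dots> = s ((z * \<rho> (gen y b)) \<otimes>\<^sub>m ?w)"
      by (simp add: tensor_mult)
    also have "\<dots> = \<tau> (z * \<rho> (\<Prod>(y, b)\<leftarrow>rev (yb @ [q]). gen y b))"
      by (simp add: snoc q unital_star_hom_simps[OF \<rho>(1)] mult.assoc)
    finally show ?case .
  qed
  have "complex_of_real (p a b x y) = \<tau> (gen x a * \<rho> (gen y b))" for x y a b
    using words[of "gen x a" "[(y, b)]"] by (simp add: assms(4))
  with trace \<rho>(1) words show ?thesis by blast
qed

end
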